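(* Let $\mathcal{E}_{\rm EVEN}=\mathcal{E}\cap K_{(2,2)}$ be the even part of the planar $3$-colorable subgroup $\mathcal{E}$ of Thompson's group $F$. The quasi-regular representation of $F$ associated with $\mathcal{E}_{\rm EVEN}$ is reducible.
   Context: For a subgroup $H$ of a (discrete) group $G$, the quasi-regular representation of $G$ associated with $H$ is the unitary representation of $G$ on $\ell^2(G/H)$ by left translations. Thompson's group $F$ is the group of piecewise linear homeomorphisms of $[0,1]$ differentiable except at finitely many dyadic rationals, with all slopes powers of $2$; the product is $(f\cdot g)(t)=g(f(t))$. $K_{(2,2)}=\{f\in F: \log_2 f'(0)\in 2\mathbb{Z},\ \log_2 f'(1)\in 2\mathbb{Z}\}$. Tree diagrams: a tree diagram is a pair $(T_+,T_-)$ of finite planar rooted binary trees with the same number $n$ of leaves. Vertices are finite binary words (root = empty word, $v0$ and $v1$ = left and right child of $v$). It represents the element of $F$ sending $.\alpha_k\gamma$ to $.\beta_k\gamma$ for each $k$ and each infinite binary word $\gamma$, where $\alpha_k,\beta_k$ are the $k$-th leaves (from left to right) of $T_+,T_-$. Every element of $F$ is so represented, uniquely up to inserting/deleting pairs of opposing carets. One draws $T_-$ upside down below $T_+$ and identifies the $k$-th leaves of the two trees. Planar $3$-colorable subgroup $\mathcal{E}$: ignoring edges sprouting upward/downward from the two roots, the diagram partitions the plane into regions: the outer region $R_0=R_n$ and, for $1\le i\le n-1$, the region $R_i$ between the $i$-th and $(i+1)$-th leaves. If $v$ is a non-root vertex of $T_+$ or $T_-$ whose descendant leaves are numbers $p+1,\dots,q$,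 the edge from $v$ to its parent separates $R_p$ from $R_q$. $\mathcal{E}$ is the subgroup of elements whose plane partition is $3$-colorable: there is a map $c$ from the regions to $\mathbb{Z}_3$ giving different colors to regions sharing an edge, i.e. $c(R_p)\neq c(R_q)$ for each such $v$. This does not depend on the tree diagram chosen. *)

theory Defs
  imports
    "HOL-Analysis.Analysis"
    "HOL-Algebra.Left_Coset"
    "HOL-Library.Numeral_Type"
    "HOL-Library.Stream"
    "HOL-Library.Sublist"
begin

section \<open>Quasi-regular representations\<close>

text \<open>Elements of \<open>\<ell>\<^sup>2(X)\<close> are functions on the whole type that vanish off \<open>X\<close>, so that
  the vector space operations are the pointwise ones.\<close>

definition l2 :: "'a set \<Rightarrow> ('a \<Rightarrow> complex) set" where
  "l2 X = {\<xi>. (\<forall>x. x \<notin> X \<longrightarrow> \<xi> x = 0) \<and> (\<lambda>x. (cmod (\<xi> x))\<^sup>2) summable_on X}"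

definition l2_norm :: "'a set \<Rightarrow> ('a \<Rightarrow> complex) \<Rightarrow> real" where
  "l2_norm X \<xi> = sqrt (\<Sum>\<^sub>\<infinity>x\<in>X. (cmod (\<xi> x))\<^sup>2)"

definition closed_l2_subspace :: "'a set \<Rightarrow> ('a \<Rightarrow> complex) set \<Rightarrow> bool" where
  "closed_l2_subspace X W \<longleftrightarrow>
     W \<subseteq> l2 X \<and>
     (\<lambda>x. 0) \<in> W \<and>
     (\<forall>\<xi>\<in>W. \<forall>\<eta>\<in>W. (\<lambda>x. \<xi> x + \<eta> x) \<in> W) \<and>
     (\<forall>c. \<forall>\<xi>\<in>W. (\<lambda>x. c * \<xi> x) \<in> W) \<and>
     (\<forall>w. \<forall>\<xi>\<in>l2 X. (\<forall>n::nat. w n \<in> W) \<longrightarrow>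
        (\<lambda>n. l2_norm X (\<lambda>x. w n x - \<xi> x)) \<longlonglongrightarrow> 0 \<longrightarrow> \<xi> \<in> W)"

definition quasi_regular ::
    "('a, 'b) monoid_scheme \<Rightarrow> 'a set \<Rightarrow> 'a \<Rightarrow> ('a set \<Rightarrow> complex) \<Rightarrow> 'a set \<Rightarrow> complex" where
  "quasi_regular G H g \<xi> C =
     (if C \<in> lcosets\<^bsub>G\<^esub> H then \<xi> (inv\<^bsub>G\<^esub> g <#\<^bsub>G\<^esub> C) else 0)"

definition reducible_on_l2 ::
    "('g, 'b) monoid_scheme \<Rightarrow> 'a set \<Rightarrow> ('g \<Rightarrow> ('a \<Rightarrow> complex) \<Rightarrow> 'a \<Rightarrow> complex) \<Rightarrow> bool" where
  "reducible_on_l2 G X \<pi> \<longleftrightarrow>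
     (\<exists>W. closed_l2_subspace X W \<and> W \<noteq> {\<lambda>x. 0} \<and> W \<noteq> l2 X \<and>
          (\<forall>g\<in>carrier G. \<forall>\<xi>\<in>W. \<pi> g \<xi> \<in> W))"

section \<open>Thompson's group \<open>F\<close>\<close>

definition dyadic_rationals :: "real set" where
  "dyadic_rationals = {of_int a / 2 ^ n | (a::int) (n::nat). True}"

definition piecewise_linear :: "(real \<Rightarrow> real) \<Rightarrow> bool" where
  "piecewise_linear f \<longleftrightarrow>
     (\<exists>S. finite S \<and>
        (\<forall>a b. {a<..<b} \<subseteq> {0..1} - S \<longrightarrow> (\<exists>m d. \<forall>t\<in>{a<..<b}. f t = m * t + d)))"

text \<open>A homeomorphism of \<open>[0,1]\<close> is represented by its extensional function on the reals; the
  derivative at an endpoint of \<open>[0,1]\<close> is one-sided.\<close>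

definition F_set :: "(real \<Rightarrow> real) set" where
  "F_set = {f \<in> extensional {0..1}.
     (\<exists>g. homeomorphism {0..1} {0..1} f g) \<and>
     piecewise_linear f \<and>
     (\<exists>D. finite D \<and> D \<subseteq> dyadic_rationals \<and>
        (\<forall>t\<in>{0..1} - D. \<exists>k::int.
           (f has_real_derivative 2 powi k) (at t within {0..1})))}"

text \<open>The product is \<open>(f \<cdot> g)(t) = g (f t)\<close>.\<close>

definition thompson_F :: "(real \<Rightarrow> real) monoid" where
  "thompson_F =
     \<lparr>carrier = F_set,
      mult = (\<lambda>f g. compose {0..1} g f),
      one = (\<lambda>t\<in>{0..1}. t)\<rparr>"

definition K22 :: "(real \<Rightarrow> real) set" where
  "K22 = {f \<in> F_set. \<forall>t\<in>{0, 1}. \<exists>s.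
     (f has_real_derivative s) (at t within {0..1}) \<and>
     (\<exists>k::int. log 2 s = 2 * of_int k)}"

section \<open>Tree diagrams\<close>

datatype btree = Leaf | Caret btree btree

text \<open>Vertices are binary words, with \<open>False\<close> for the digit 0 (left) and \<open>True\<close> for 1 (right).\<close>

fun vertices :: "btree \<Rightarrow> bool list set" where
  "vertices Leaf = {[]}"
| "vertices (Caret l r) = {[]} \<union> (#) False ` vertices l \<union> (#) True ` vertices r"

fun leaves :: "btree \<Rightarrow> bool list list" where
  "leaves Leaf = [[]]"
| "leaves (Caret l r) = map ((#) False) (leaves l) @ map ((#) True) (leaves r)"

definition tree_diagram :: "btree \<Rightarrow> btree \<Rightarrow> bool" where
  "tree_diagram T U \<longleftrightarrow> length (leaves T) = length (leaves U)"

definition binary_value :: "bool stream \<Rightarrow> real" where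
  "binary_value \<gamma> = (\<Sum>n. of_bool (\<gamma> !! n) / 2 ^ Suc n)"

definition represents :: "btree \<Rightarrow> btree \<Rightarrow> (real \<Rightarrow> real) \<Rightarrow> bool" where
  "represents T U f \<longleftrightarrow>
     (\<forall>k < length (leaves T). \<forall>\<gamma>.
        f (binary_value (leaves T ! k @- \<gamma>)) = binary_value (leaves U ! k @- \<gamma>))"

section \<open>The planar 3-colorable subgroup\<close>

text \<open>The descendant leaves of a vertex, numbered from 1 as the \<open>i\<close>-th leaf is \<open>leaves T ! (i - 1)\<close>.\<close>

definition descendant_leaves :: "btree \<Rightarrow> bool list \<Rightarrow> nat set" where
  "descendant_leaves T v = {i \<in> {1..length (leaves T)}. prefix v (leaves T ! (i - 1))}"

text \<open>The edges from the non-root vertices of \<open>T\<close> to their parents separate regions of different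
  colors; region \<open>R\<^sub>i\<close> has color \<open>c i\<close>, and \<open>3\<close> is the type of integers modulo 3.\<close>

definition separates_colors :: "btree \<Rightarrow> (nat \<Rightarrow> 3) \<Rightarrow> bool" where
  "separates_colors T c \<longleftrightarrow>
     (\<forall>v\<in>vertices T - {[]}. \<forall>p q. p < q \<longrightarrow> descendant_leaves T v = {p+1..q} \<longrightarrow> c p \<noteq> c q)"

text \<open>\<open>R\<^sub>0\<close> and \<open>R\<^sub>n\<close> are the same (outer) region.\<close>

definition three_colorable :: "btree \<Rightarrow> btree \<Rightarrow> bool" where
  "three_colorable T U \<longleftrightarrow>
     (\<exists>c. c 0 = c (length (leaves T)) \<and> separates_colors T c \<and> separates_colors U c)"

definition planar_3_colorable :: "(real \<Rightarrow> real) set" where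
  "planar_3_colorable =
     {f \<in> F_set. \<exists>T U. tree_diagram T U \<and> represents T U f \<and> three_colorable T U}"

definition E_EVEN :: "(real \<Rightarrow> real) set" where
  "E_EVEN = planar_3_colorable \<inter> K22"

end

theory Submission
  imports Defs
begin

text \<open>Let \<open>H\<close> be a subgroup of \<open>G\<close> and let \<open>g \<notin> H\<close> normalize \<open>H\<close> with \<open>g\<^sup>2 \<in> H\<close>. Right translation
  by \<open>g\<close> is then an involution of \<open>\<ell>\<^sup>2(G/H)\<close> that commutes with the left translations, and its fixed
  vectors form a proper nonzero closed invariant subspace. For \<open>H = \<E>\<^sub>E\<^sub>V\<^sub>E\<^sub>N\<close> such a \<open>g\<close> is the standard
  generator \<open>x\<^sub>0\<close> of \<open>F\<close>: it lies in \<open>\<E>\<close>, its slope at 0 is an odd power of 2, and \<open>K\<^sub>(\<^sub>2\<^sub>,\<^sub>2\<^sub>)\<close> is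
  normal, being defined by the parity of the homomorphisms \<open>log\<^sub>2 f'(0)\<close> and \<open>log\<^sub>2 f'(1)\<close>.

  That \<open>\<E>\<close> is a subgroup follows from a local description of three-colorability. If the regions
  to the left and right of a non-root vertex have different colors, the color between its two
  children is forced, so the color jump across a vertex changes sign at each further level. The
  colors are therefore determined by the jumps \<open>\<plusminus>1\<close> across the leaves, whose signs depend only on the
  depth of the leaf and on the first digit of its word.\<close>

section \<open>Reducibility from a normalizing involution\<close>

lemma l2_add:
  assumes "\<xi> \<in> l2 X" "\<eta> \<in> l2 X"
  shows "(\<lambda>x. \<xi> x + \<eta> x) \<in> l2 X"
proof -
  \<comment> \<open>The majorant comes from \<open>(a + b)^2 <= 2 a^2 + 2 b^2\<close>.\<close>
  have "(\<lambda>x. 2 * (cmod (\<xi> x))\<^sup>2 + 2 * (cmod (\<eta> x))\<^sup>2) summable_on X"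
    using assms unfolding l2_def by (intro summable_on_add summable_on_cmult_right) auto
  then have "(\<lambda>x. norm (2 * (cmod (\<xi> x))\<^sup>2 + 2 * (cmod (\<eta> x))\<^sup>2)) summable_on X"
    by simp
  then have "(\<lambda>x. norm ((cmod (\<xi> x + \<eta> x))\<^sup>2)) summable_on X"
  proof (rule Infinite_Sum.abs_summable_on_comparison_test)
    fix x
    have "(cmod (\<xi> x + \<eta> x))\<^sup>2 \<le> (cmod (\<xi> x) + cmod (\<eta> x))\<^sup>2"
      by (intro power_mono norm_triangle_ineq) simp
    also have "\<dots> \<le> 2 * (cmod (\<xi> x))\<^sup>2 + 2 * (cmod (\<eta> x))\<^sup>2"
      using sum_squares_bound[of "cmod (\<xi> x)" "cmod (\<eta> x)"] by (simp add: power2_sum)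
    finally show "norm ((cmod (\<xi> x + \<eta> x))\<^sup>2) \<le> norm (2 * (cmod (\<xi> x))\<^sup>2 + 2 * (cmod (\<eta> x))\<^sup>2)"
      by simp
  qed
  then show ?thesis using assms unfolding l2_def by simp
qed

lemma l2_scale:
  assumes "\<xi> \<in> l2 X"
  shows "(\<lambda>x. c * \<xi> x) \<in> l2 X"
  using assms unfolding l2_def
  by (auto simp: norm_mult power_mult_distrib intro: summable_on_cmult_right)

lemma l2_diff:
  assumes "\<xi> \<in> l2 X" "\<eta> \<in> l2 X"
  shows "(\<lambda>x. \<xi> x - \<eta> x) \<in> l2 X"
  using l2_add[OF assms(1) l2_scale[OF assms(2), of "-1"]] by simp

text \<open>A single term of a sum of nonnegative terms is at most the whole sum, and off
  \<open>X\<close> the value is 0.\<close>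

lemma cmod_le_l2_norm:
  assumes "\<xi> \<in> l2 X"
  shows "cmod (\<xi> x) \<le> l2_norm X \<xi>"
proof (cases "x \<in> X")
  case True
  have "(\<Sum>y\<in>{x}. (cmod (\<xi> y))\<^sup>2) \<le> (\<Sum>\<^sub>\<infinity>y\<in>X. (cmod (\<xi> y))\<^sup>2)"
    using assms True unfolding l2_def by (intro finite_sum_le_infsum) auto
  then show ?thesis unfolding l2_norm_def by (simp add: real_le_rsqrt)
next
  case False
  then show ?thesis using assms unfolding l2_def l2_norm_def by (auto intro: infsum_nonneg)
qed

text \<open>Evaluation at a point is bounded by the norm. Hence a subspace of \<open>l2 X\<close>
  cut out by equations between values is closed.\<close>

lemma l2_norm_tendsto_imp_pointwise:
  assumes "\<And>n. w n \<in> l2 X" "\<xi> \<in> l2 X" "(\<lambda>n. l2_norm X (\<lambda>x. w n x - \<xi> x)) \<longlonglongrightarrow> 0"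
  shows "(\<lambda>n. w n x) \<longlonglongrightarrow> \<xi> x"
proof (rule LIM_zero_cancel, rule Lim_null_comparison[OF _ assms(3)])
  show "\<forall>\<^sub>F n in sequentially. norm (w n x - \<xi> x) \<le> l2_norm X (\<lambda>x. w n x - \<xi> x)"
    using cmod_le_l2_norm[OF l2_diff[OF assms(1,2)]] by simp
qed

lemma finite_support_in_l2:
  assumes "finite S" "S \<subseteq> X" "\<And>x. x \<notin> S \<Longrightarrow> \<xi> x = 0"
  shows "\<xi> \<in> l2 X"
proof -
  have "(\<lambda>x. (cmod (\<xi> x))\<^sup>2) summable_on X \<longleftrightarrow> (\<lambda>x. (cmod (\<xi> x))\<^sup>2) summable_on S"
    by (rule summable_on_cong_neutral) (use assms in auto)
  then show ?thesis using assms unfolding l2_def by auto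
qed

section \<open>Left and right translations on the space of left cosets\<close>

context group
begin

lemma l_coset_in_lcosets: "a \<in> carrier G \<Longrightarrow> a <# H \<in> lcosets H"
  unfolding LCOSETS_def by blast

text \<open>Translation by \<open>inv k\<close> is the two-sided inverse. The bijection lets sums
  over \<open>lcosets H\<close> be reindexed, so that the quasi-regular operators preserve square
  summability.\<close>

lemma l_coset_mult_bij:
  assumes "H \<subseteq> carrier G" "k \<in> carrier G"
  shows "bij_betw (\<lambda>C. k <# C) (lcosets H) (lcosets H)"
proof (rule bij_betw_byWitness[where f' = "\<lambda>C. inv k <# C"])
  have *: "inv k <# (k <# C) = C" "k <# (inv k <# C) = C" "k <# C \<in> lcosets H" "inv k <# C \<in> lcosets H"
    if C: "C \<in> lcosets H" for C
  proof -
    obtain a where a: "a \<in> carrier G" "C = a <# H" using C unfolding LCOSETS_def by blast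
    have "k <# C = (k \<otimes> a) <# H" "inv k <# C = (inv k \<otimes> a) <# H"
      using a assms by (simp_all add: lcos_m_assoc)
    then show "inv k <# (k <# C) = C" "k <# (inv k <# C) = C"
      "k <# C \<in> lcosets H" "inv k <# C \<in> lcosets H"
      using a assms by (simp_all add: lcos_m_assoc m_assoc[symmetric] l_coset_in_lcosets)
  qed
  show "\<forall>C\<in>lcosets H. inv k <# (k <# C) = C" "\<forall>C\<in>lcosets H. k <# (inv k <# C) = C"
    "l_coset G k ` (lcosets H) \<subseteq> lcosets H" "l_coset G (inv k) ` (lcosets H) \<subseteq> lcosets H"
    using * by auto
qed

lemma quasi_regular_in_l2:
  assumes "H \<subseteq> carrier G" "k \<in> carrier G" "\<xi> \<in> l2 (lcosets H)"
  shows "quasi_regular G H k \<xi> \<in> l2 (lcosets H)"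
proof -
  have "(\<lambda>C. (cmod (\<xi> (inv k <# C)))\<^sup>2) summable_on lcosets H"
    using summable_on_reindex_bij_betw[OF l_coset_mult_bij[of H "inv k"], of "\<lambda>C. (cmod (\<xi> C))\<^sup>2"] assms
    unfolding l2_def by simp
  then have "(\<lambda>C. (cmod (quasi_regular G H k \<xi> C))\<^sup>2) summable_on lcosets H"
    by (rule summable_on_cong[THEN iffD1, rotated]) (simp add: quasi_regular_def)
  then show ?thesis unfolding l2_def by (simp add: quasi_regular_def)
qed

text \<open>Since \<open>g\<close> normalizes \<open>H\<close>, right translation by
  \<open>g\<close> sends the coset \<open>aH\<close> to the coset \<open>agH\<close>. It is an
  involution because \<open>g \<otimes> g\<close> lies in \<open>H\<close>, and it moves
  \<open>H\<close> because \<open>g\<close> does not. The invariant subspace consists of the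
  functions constant on its orbits.\<close>

lemma quasi_regular_reducible:
  assumes H: "subgroup H G" and g: "g \<in> carrier G" "g \<notin> H" "g \<otimes> g \<in> H"
    and normalizes: "\<And>h. h \<in> H \<Longrightarrow> inv g \<otimes> h \<otimes> g \<in> H"
  shows "reducible_on_l2 G (lcosets H) (quasi_regular G H)"
proof -
  interpret H: subgroup H G by fact
  have Hc: "H \<subseteq> carrier G" by (rule H.subset)
  let ?X = "lcosets H"
  define W where "W = {\<xi> \<in> l2 ?X. \<forall>C\<in>?X. \<xi> (C #> g) = \<xi> C}"
  have cancel: "g \<otimes> (inv g \<otimes> x) = x" "inv g \<otimes> (g \<otimes> x) = x" if "x \<in> carrier G" for x
    using g(1) that by (simp_all add: m_assoc[symmetric])
  have coset_g: "(a <# H) #> g = (a \<otimes> g) <# H" if a: "a \<in> carrier G" for a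
  proof (intro subset_antisym subsetI)
    fix x assume "x \<in> (a <# H) #> g"
    then obtain h where h: "h \<in> H" "x = a \<otimes> h \<otimes> g"
      unfolding l_coset_def r_coset_def by blast
    then have "x = (a \<otimes> g) \<otimes> (inv g \<otimes> h \<otimes> g)"
      using a g(1) by (simp add: m_assoc cancel)
    then show "x \<in> (a \<otimes> g) <# H" using normalizes[OF h(1)] unfolding l_coset_def by blast
  next
    fix x assume "x \<in> (a \<otimes> g) <# H"
    then obtain h where h: "h \<in> H" "x = a \<otimes> g \<otimes> h" unfolding l_coset_def by blast
    \<comment> \<open>Only conjugation in one direction is assumed to preserve \<open>H\<close>. The
      other direction follows by conjugating once more with \<open>s\<close>, an element of
      \<open>H\<close>: \<open>g h g^-1 = s (g^-1 h g) s^-1\<close>.\<close>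
    define s where "s = g \<otimes> g"
    have s: "s \<in> H" using g by (simp add: s_def)
    have "s \<otimes> (inv g \<otimes> h \<otimes> g) \<otimes> inv s \<in> H"
      using normalizes[OF h(1)] s by simp
    moreover have "s \<otimes> (inv g \<otimes> h \<otimes> g) \<otimes> inv s = g \<otimes> h \<otimes> inv g"
      using h(1) g(1) unfolding s_def by (simp add: m_assoc inv_mult_group cancel)
    moreover have "x = a \<otimes> (g \<otimes> h \<otimes> inv g) \<otimes> g"
      using a h g(1) by (simp add: m_assoc)
    ultimately show "x \<in> (a <# H) #> g" unfolding l_coset_def r_coset_def by auto
  qed
  \<comment> \<open>Left and right translations of cosets commute.\<close>
  have fix_inv: "quasi_regular G H k \<xi> (C #> g) = quasi_regular G H k \<xi> C"
    if k: "k \<in> carrier G" and \<xi>: "\<forall>C\<in>?X. \<xi> (C #> g) = \<xi> C" and C: "C \<in> ?X" for k \<xi> C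
  proof -
    obtain a where a: "a \<in> carrier G" "C = a <# H" using C unfolding LCOSETS_def by blast
    have "inv k <# (C #> g) = (inv k \<otimes> a <# H) #> g"
      using a k g by (simp add: coset_g lcos_m_assoc Hc m_assoc)
    moreover have "inv k <# C = inv k \<otimes> a <# H"
      using a k by (simp add: lcos_m_assoc Hc)
    ultimately show ?thesis
      using a k g(1) bspec[OF \<xi>, of "inv k \<otimes> a <# H"] by (simp add: quasi_regular_def coset_g l_coset_in_lcosets)
  qed
  have gH: "g <# H \<noteq> H" using lcos_self[OF g(1) H] g(2) by auto
  have X1: "H \<in> ?X" using l_coset_in_lcosets[of \<one> H] by (simp add: lcos_mult_one Hc)
  have X2: "g <# H \<in> ?X" using l_coset_in_lcosets g(1) by blast
  have Hg: "H #> g = g <# H" using coset_g[of \<one>] g(1) by (simp add: lcos_mult_one Hc)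
  have ggH: "(g <# H) #> g = H" using coset_g[of g] g by (simp add: coset_join3 H)
  \<comment> \<open>The indicator of the single coset \<open>H\<close> witnesses that
    \<open>W\<close> is proper, the indicator of the orbit of \<open>H\<close> under right
    translation that \<open>W\<close> is nonzero.\<close>
  define \<delta> where "\<delta> = (\<lambda>C. of_bool (C = H) :: complex)"
  define \<epsilon> where "\<epsilon> = (\<lambda>C. of_bool (C = H \<or> C = g <# H) :: complex)"
  have \<delta>: "\<delta> \<in> l2 ?X" unfolding \<delta>_def by (rule finite_support_in_l2[of "{H}"]) (use X1 in auto)
  have \<epsilon>: "\<epsilon> \<in> l2 ?X" unfolding \<epsilon>_def by (rule finite_support_in_l2[of "{H, g <# H}"]) (use X1 X2 in auto)
  have "\<delta> (H #> g) \<noteq> \<delta> H" unfolding \<delta>_def Hg using gH by simp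
  then have "\<delta> \<notin> W" unfolding W_def using X1 by blast
  have inv2: "(C #> g) #> g = C" if C: "C \<in> ?X" for C
  proof -
    obtain a where a: "a \<in> carrier G" "C = a <# H" using C unfolding LCOSETS_def by blast
    have "(a \<otimes> g \<otimes> g) <# H = a <# ((g \<otimes> g) <# H)"
      using a g by (simp add: lcos_m_assoc Hc m_assoc)
    then show ?thesis using a g by (simp add: coset_g coset_join3 H)
  qed
  have "\<epsilon> (C #> g) = \<epsilon> C" if C: "C \<in> ?X" for C
  proof -
    have "C #> g = H \<or> C #> g = g <# H \<longleftrightarrow> C = H \<or> C = g <# H"
      using inv2[OF C] Hg ggH by metis
    then show ?thesis unfolding \<epsilon>_def by simp
  qed
  then have "\<epsilon> \<in> W" using \<epsilon> unfolding W_def by blast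
  moreover have "\<epsilon> H = 1" unfolding \<epsilon>_def by simp
  ultimately have "W \<noteq> {\<lambda>x. 0}" by (metis singletonD zero_neq_one)
  have "closed_l2_subspace ?X W"
    unfolding closed_l2_subspace_def
  proof (intro conjI ballI allI impI)
    show "W \<subseteq> l2 ?X" unfolding W_def by blast
    show "(\<lambda>x. 0) \<in> W" unfolding W_def by (simp add: finite_support_in_l2[of "{}"])
    show "(\<lambda>x. \<xi> x + \<eta> x) \<in> W" if "\<xi> \<in> W" "\<eta> \<in> W" for \<xi> \<eta>
      using that unfolding W_def by (simp add: l2_add)
    show "(\<lambda>x. c * \<xi> x) \<in> W" if "\<xi> \<in> W" for c \<xi>
      using that unfolding W_def by (simp add: l2_scale)
  next
    fix w \<xi>
    assume \<xi>: "\<xi> \<in> l2 ?X" and w: "\<forall>n::nat. w n \<in> W"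
      and lim: "(\<lambda>n. l2_norm ?X (\<lambda>x. w n x - \<xi> x)) \<longlonglongrightarrow> 0"
    have ptw: "(\<lambda>n. w n C) \<longlonglongrightarrow> \<xi> C" for C
      by (rule l2_norm_tendsto_imp_pointwise[OF _ \<xi> lim]) (use w in \<open>simp add: W_def\<close>)
    have "\<xi> (C #> g) = \<xi> C" if "C \<in> ?X" for C
    proof (rule LIMSEQ_unique[OF ptw])
      show "(\<lambda>n. w n (C #> g)) \<longlonglongrightarrow> \<xi> C" using ptw[of C] w that by (simp add: W_def)
    qed
    then show "\<xi> \<in> W" using \<xi> unfolding W_def by blast
  qed
  moreover have "quasi_regular G H k \<xi> \<in> W" if "k \<in> carrier G" "\<xi> \<in> W" for k \<xi>
    using that fix_inv quasi_regular_in_l2[OF Hc] unfolding W_def by blast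
  ultimately show ?thesis
    unfolding reducible_on_l2_def using \<open>W \<noteq> {\<lambda>x. 0}\<close> \<open>\<delta> \<notin> W\<close> \<delta> by blast
qed

end

section \<open>Gap-affine maps and dyadic breakpoints\<close>

lemma dyadic_of_int: "of_int a \<in> dyadic_rationals"
  unfolding dyadic_rationals_def by (rule CollectI, rule exI[of _ a], rule exI[of _ 0]) simp

lemma dyadic_add:
  assumes "x \<in> dyadic_rationals" "y \<in> dyadic_rationals"
  shows "x + y \<in> dyadic_rationals"
proof -
  obtain a b m n where "x = of_int a / 2 ^ m" "y = of_int b / 2 ^ n"
    using assms unfolding dyadic_rationals_def by blast
  then have "x + y = of_int (a * 2 ^ n + b * 2 ^ m) / 2 ^ (m + n)"
    by (simp add: add_frac_eq power_add)
  then show ?thesis unfolding dyadic_rationals_def by blast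
qed

lemma dyadic_mult:
  assumes "x \<in> dyadic_rationals" "y \<in> dyadic_rationals"
  shows "x * y \<in> dyadic_rationals"
proof -
  obtain a b m n where "x = of_int a / 2 ^ m" "y = of_int b / 2 ^ n"
    using assms unfolding dyadic_rationals_def by blast
  then have "x * y = of_int (a * b) / 2 ^ (m + n)"
    by (simp add: power_add)
  then show ?thesis unfolding dyadic_rationals_def by blast
qed

lemma dyadic_diff:
  assumes "x \<in> dyadic_rationals" "y \<in> dyadic_rationals"
  shows "x - y \<in> dyadic_rationals"
  using dyadic_add[OF assms(1) dyadic_mult[OF dyadic_of_int[of "-1"] assms(2)]] by simp

lemma dyadic_powi: "2 powi k \<in> dyadic_rationals"
proof (cases "k \<ge> 0")
  case True
  then have "2 powi k = of_int (2 ^ nat k) / (2::real) ^ 0" by (simp add: power_int_def)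
  then show ?thesis unfolding dyadic_rationals_def by blast
next
  case False
  then have "2 powi k = of_int 1 / (2::real) ^ nat (- k)" by (simp add: power_int_def field_simps)
  then show ?thesis unfolding dyadic_rationals_def by blast
qed

text \<open>The inverse affine map has the same shape, with slope \<open>2 powi (- k)\<close> and
  the roles of \<open>a\<close> and \<open>b\<close> exchanged.\<close>

lemma dyadic_affine_iff:
  assumes "a \<in> dyadic_rationals" "b \<in> dyadic_rationals"
  shows "b + 2 powi k * (t - a) \<in> dyadic_rationals \<longleftrightarrow> t \<in> dyadic_rationals" (is "?y \<in> _ \<longleftrightarrow> _")
proof
  assume "?y \<in> dyadic_rationals"
  then have "a + 2 powi (- k) * (?y - b) \<in> dyadic_rationals"
    using assms by (intro dyadic_add[of a] dyadic_mult dyadic_powi dyadic_diff[of ?y])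
  moreover have "a + 2 powi (- k) * (?y - b) = t"
    by (simp add: power_int_minus mult.assoc[symmetric])
  ultimately show "t \<in> dyadic_rationals" by simp
qed (use assms in \<open>intro dyadic_add dyadic_mult dyadic_powi dyadic_diff\<close>)

section \<open>Darboux's theorem and derivatives that are powers of 2\<close>

text \<open>The function \<open>f t - c * t\<close> attains a minimum on \<open>{u..v}\<close>. Its
  derivative is negative at \<open>u\<close> and positive at \<open>v\<close>, so the minimum is
  interior and the derivative of \<open>f\<close> there is \<open>c\<close>.\<close>

lemma darboux_increasing:
  fixes f :: "real \<Rightarrow> real"
  assumes "u < v" and d: "\<And>t. t \<in> {u..v} \<Longrightarrow> (f has_real_derivative f' t) (at t)"
    and c: "f' u < c" "c < f' v"
  shows "\<exists>w\<in>{u..v}. f' w = c"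
proof -
  define h where "h = (\<lambda>t. f t - c * t)"
  have dh: "(h has_real_derivative f' t - c) (at t)" if "t \<in> {u..v}" for t
    unfolding h_def by (rule derivative_eq_intros d that refl | simp)+
  have "continuous_on {u..v} h"
    by (meson DERIV_isCont continuous_at_imp_continuous_on dh)
  then obtain w where w: "w \<in> {u..v}" "\<And>t. t \<in> {u..v} \<Longrightarrow> h w \<le> h t"
    using continuous_attains_inf[of "{u..v}" h] \<open>u < v\<close> by auto
  have "w \<noteq> u"
  proof
    assume "w = u"
    have "f' u - c < 0" using c by simp
    then obtain e where e: "e > 0" "\<And>s. 0 < s \<Longrightarrow> s < e \<Longrightarrow> h (u + s) < h u"
      using DERIV_neg_dec_right[OF dh[of u]] \<open>u < v\<close> by auto
    define s where "s = min (e / 2) (v - u)"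
    have "h (u + s) < h u" using e \<open>u < v\<close> by (simp add: s_def)
    moreover have "u + s \<in> {u..v}" using e \<open>u < v\<close> by (auto simp: s_def)
    ultimately show False using w(2)[of "u + s"] \<open>w = u\<close> by simp
  qed
  moreover have "w \<noteq> v"
  proof
    assume "w = v"
    have "f' v - c > 0" using c by simp
    then obtain e where e: "e > 0" "\<And>s. 0 < s \<Longrightarrow> s < e \<Longrightarrow> h (v - s) < h v"
      using DERIV_pos_inc_left[OF dh[of v]] \<open>u < v\<close> by auto
    define s where "s = min (e / 2) (v - u)"
    have "h (v - s) < h v" using e \<open>u < v\<close> by (simp add: s_def)
    moreover have "v - s \<in> {u..v}" using e \<open>u < v\<close> by (auto simp: s_def)
    ultimately show False using w(2)[of "v - s"] \<open>w = v\<close> by simp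
  qed
  ultimately have "u < w" "w < v" using w(1) by auto
  then have "f' w - c = 0"
    using DERIV_local_min[OF dh[OF w(1)], of "min (w - u) (v - w)"] w(2) by (auto simp: abs_if)
  then show ?thesis using w(1) by auto
qed

lemma darboux:
  fixes f :: "real \<Rightarrow> real"
  assumes "u < v" and d: "\<And>t. t \<in> {u..v} \<Longrightarrow> (f has_real_derivative f' t) (at t)"
    and c: "min (f' u) (f' v) < c" "c < max (f' u) (f' v)"
  shows "\<exists>w\<in>{u..v}. f' w = c"
proof (cases "f' u < f' v")
  case True
  then show ?thesis using darboux_increasing[OF assms(1) d] c by auto
next
  case False
  then have "\<exists>w\<in>{u..v}. - f' w = - c"
    using c by (intro darboux_increasing[OF assms(1), of "\<lambda>t. - f t"] DERIV_minus d) auto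
  then show ?thesis by auto
qed

text \<open>The number \<open>3 / 2 * 2 powi i\<close> lies strictly between two consecutive powers
  of 2. It serves as the intermediate value that a derivative with powers of 2 as values would have
  to take if it were not constant.\<close>

lemma powi_strict_between:
  fixes i j k :: int
  assumes "i < j"
  shows "2 powi i < 3 / 2 * (2::real) powi i" "3 / 2 * 2 powi i < (2::real) powi j"
    "2 powi k \<noteq> 3 / 2 * (2::real) powi i"
proof -
  have p: "(2::real) powi i > 0" by simp
  have s: "(2::real) powi (i + 1) = 2 * 2 powi i" by (simp add: power_int_add)
  show 1: "2 powi i < 3 / 2 * (2::real) powi i" using p by simp
  have "(2::real) powi (i + 1) \<le> 2 powi j" using assms by (intro power_int_increasing) auto
  then show "3 / 2 * 2 powi i < (2::real) powi j" using p s by linarith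
  show "2 powi k \<noteq> 3 / 2 * (2::real) powi i"
  proof (cases "k \<le> i")
    case True
    then have "(2::real) powi k \<le> 2 powi i" by (intro power_int_increasing) auto
    then show ?thesis using 1 by linarith
  next
    case False
    then have "(2::real) powi (i + 1) \<le> 2 powi k" by (intro power_int_increasing) auto
    then show ?thesis using s p by linarith
  qed
qed

text \<open>By Darboux's theorem a derivative with values in the discrete set of powers of 2 is constant.\<close>

lemma affine_if_deriv_powi:
  fixes f :: "real \<Rightarrow> real"
  assumes "a < b" "continuous_on {a..b} f"
    and "\<And>t. t \<in> {a<..<b} \<Longrightarrow> \<exists>k::int. (f has_real_derivative 2 powi k) (at t)"
  shows "\<exists>k::int. \<forall>t\<in>{a..b}. f t = f a + 2 powi k * (t - a)"
proof -
  obtain \<kappa> where \<kappa>: "\<And>t. t \<in> {a<..<b} \<Longrightarrow> (f has_real_derivative 2 powi (\<kappa> t :: int)) (at t)"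
    using assms(3) by metis
  have eq: "\<kappa> u = \<kappa> v" if "u \<in> {a<..<b}" "v \<in> {a<..<b}" "u < v" for u v
  proof (rule ccontr)
    assume ne: "\<kappa> u \<noteq> \<kappa> v"
    define i where "i = min (\<kappa> u) (\<kappa> v)"
    define j where "j = max (\<kappa> u) (\<kappa> v)"
    have ij: "i < j" using ne by (auto simp: i_def j_def)
    have "min (2 powi \<kappa> u) (2 powi \<kappa> v) = (2::real) powi i"
      "max (2 powi \<kappa> u) (2 powi \<kappa> v) = (2::real) powi j"
      using power_int_increasing[of i j "2::real"] ij
      by (auto simp: i_def j_def min_def max_def split: if_splits)
    then have "\<exists>w\<in>{u..v}. 2 powi \<kappa> w = 3 / 2 * (2::real) powi i"
      using powi_strict_between[OF ij] that by (intro darboux[of u v f] \<kappa>) auto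
    then show False using powi_strict_between(3)[OF ij] by blast
  qed
  define k where "k = \<kappa> ((a + b) / 2)"
  have k: "\<kappa> t = k" if "t \<in> {a<..<b}" for t
  proof -
    have "(a + b) / 2 \<in> {a<..<b}" using assms(1) by simp
    then show ?thesis
      using eq[of t "(a + b) / 2"] eq[of "(a + b) / 2" t] that unfolding k_def
      by (metis less_linear)
  qed
  \<comment> \<open>The derivative of \<open>h\<close> vanishes on the open interval, and continuity
    carries the constancy of \<open>h\<close> to the closed one.\<close>
  define h where "h = (\<lambda>t. f t - 2 powi k * t)"
  have dh: "DERIV h t :> 0" if "a < t" "t < b" for t
    unfolding h_def using \<kappa>[of t] k[of t] that
    by (intro derivative_eq_intros) auto
  have "continuous_on {a..b} h"
    unfolding h_def by (intro continuous_intros assms(2))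
  then have "h t = h a" if "t \<in> {a..b}" for t
    using DERIV_isconst2[OF assms(1) _ dh, of t] that by auto
  then have "f t = f a + 2 powi k * (t - a)" if "t \<in> {a..b}" for t
    using \<open>\<And>t. t \<in> {a..b} \<Longrightarrow> h t = h a\<close>[OF that] by (simp add: h_def right_diff_distrib)
  then show ?thesis by blast
qed

section \<open>Affine pieces between break points\<close>

text \<open>A derivative-free form of the slope condition. The formula holds on the closed interval,
  so that consecutive pieces can be chained at their common endpoint.\<close>

definition gap_affine :: "real set \<Rightarrow> (real \<Rightarrow> real) \<Rightarrow> bool" where
  "gap_affine D f \<longleftrightarrow>
     (\<forall>a b. 0 \<le> a \<longrightarrow> a < b \<longrightarrow> b \<le> 1 \<longrightarrow> {a<..<b} \<inter> D = {} \<longrightarrow>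
        (\<exists>k::int. \<forall>t\<in>{a..b}. f t = f a + 2 powi k * (t - a)))"

lemma gap_affineE:
  assumes "gap_affine D f" "0 \<le> a" "a < b" "b \<le> 1" "{a<..<b} \<inter> D = {}"
  obtains k :: int where "\<forall>t\<in>{a..b}. f t = f a + 2 powi k * (t - a)"
  using assms unfolding gap_affine_def by meson

lemma gap_affine_ends:
  assumes "gap_affine D f" "0 \<le> a" "a < b" "b \<le> 1" "{a<..<b} \<inter> D = {}"
  shows "\<exists>k::int. f b = f a + 2 powi k * (b - a)"
proof -
  obtain k :: int where "\<forall>t\<in>{a..b}. f t = f a + 2 powi k * (t - a)"
    by (rule gap_affineE[OF assms])
  then have "f b = f a + 2 powi k * (b - a)" by (rule bspec) (use assms(3) in simp)
  then show ?thesis by blast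
qed

text \<open>From left to right, the derivative is constant on every gap by Darboux's theorem. From
  right to left, linearity and the slopes are read off the affine formula.\<close>

lemma F_set_iff_gap_affine:
  "f \<in> F_set \<longleftrightarrow>
     f \<in> extensional {0..1} \<and> (\<exists>g. homeomorphism {0..1} {0..1} f g) \<and>
     (\<exists>D. finite D \<and> D \<subseteq> dyadic_rationals \<and> gap_affine D f)" (is "_ \<longleftrightarrow> ?R")
proof
  assume f: "f \<in> F_set"
  then obtain D where D: "finite D" "D \<subseteq> dyadic_rationals"
    "\<And>t. t \<in> {0..1} - D \<Longrightarrow> \<exists>k::int. (f has_real_derivative 2 powi k) (at t within {0..1})"
    unfolding F_set_def by blast
  have cont: "continuous_on {0..1} f"
    using f unfolding F_set_def by (auto dest: homeomorphism_cont1)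
  have "gap_affine D f"
    unfolding gap_affine_def
  proof (intro allI impI)
    fix a b :: real assume ab: "0 \<le> a" "a < b" "b \<le> 1" "{a<..<b} \<inter> D = {}"
    show "\<exists>k::int. \<forall>t\<in>{a..b}. f t = f a + 2 powi k * (t - a)"
    proof (rule affine_if_deriv_powi)
      show "continuous_on {a..b} f" using cont by (rule continuous_on_subset) (use ab in auto)
      show "\<exists>k::int. (f has_real_derivative 2 powi k) (at t)" if "t \<in> {a<..<b}" for t
      proof -
        have "at t within {0..1} = at t"
          by (rule at_within_interior) (use ab that in auto)
        then show ?thesis using D(3)[of t] ab that by fastforce
      qed
    qed fact
  qed
  then show ?R using D f unfolding F_set_def by blast
next
  assume ?R
  then obtain D where f: "f \<in> extensional {0..1}" "\<exists>g. homeomorphism {0..1} {0..1} f g"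
    and D: "finite D" "D \<subseteq> dyadic_rationals" and ga: "gap_affine D f" by blast
  have "piecewise_linear f"
    unfolding piecewise_linear_def
  proof (intro exI[of _ D] conjI allI impI D)
    fix a b :: real assume ab: "{a<..<b} \<subseteq> {0..1} - D"
    show "\<exists>m d. \<forall>t\<in>{a<..<b}. f t = m * t + d"
    proof (cases "a < b")
      case True
      \<comment> \<open>Only the open interval is known to lie in \<open>{0..1}\<close>; its closure
        gives the bounds on \<open>a\<close> and \<open>b\<close>.\<close>
      have "closure {a<..<b} \<subseteq> {0..1}" using ab by (intro closure_minimal) auto
      then have "0 \<le> a" "b \<le> 1" using True by auto
      have gap: "{a<..<b} \<inter> D = {}" using ab by blast
      obtain k :: int where "\<forall>t\<in>{a..b}. f t = f a + 2 powi k * (t - a)"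
        by (rule gap_affineE[OF ga \<open>0 \<le> a\<close> True \<open>b \<le> 1\<close> gap])
      then have "\<forall>t\<in>{a<..<b}. f t = 2 powi k * t + (f a - 2 powi k * a)"
        by (auto simp: algebra_simps)
      then show ?thesis by blast
    qed auto
  qed
  \<comment> \<open>With 0 and 1 counted as break points, each remaining \<open>t\<close> has a
    two-sided neighborhood inside a gap.\<close>
  moreover have "\<exists>k::int. (f has_real_derivative 2 powi k) (at t within {0..1})"
    if t: "t \<in> {0..1} - (D \<union> {0, 1})" for t
  proof -
    have "open ({0<..<1} - D)" using D by (intro open_Diff finite_imp_closed) auto
    moreover have "t \<in> {0<..<1} - D" using t by auto
    ultimately obtain e where e: "e > 0" "cball t e \<subseteq> {0<..<1} - D"
      using open_contains_cball by blast
    have I: "{t - e..t + e} \<subseteq> {0<..<1} - D" using e by (simp add: cball_eq_atLeastAtMost)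
    have "t - e \<in> {0<..<1} - D" "t + e \<in> {0<..<1} - D"
      using e(1) by (intro subsetD[OF I]; simp)+
    then have te: "0 \<le> t - e" "t - e < t + e" "t + e \<le> 1" using e(1) by auto
    have gap: "{t - e<..<t + e} \<inter> D = {}"
    proof (rule equals0I)
      fix s assume s: "s \<in> {t - e<..<t + e} \<inter> D"
      then have "s \<in> {0<..<1} - D" by (intro subsetD[OF I]) simp
      then show False using s by blast
    qed
    obtain k :: int where k: "\<forall>s\<in>{t - e..t + e}. f s = f (t - e) + 2 powi k * (s - (t - e))"
      by (rule gap_affineE[OF ga te gap])
    have "((\<lambda>s. f (t - e) + 2 powi k * (s - (t - e))) has_real_derivative 2 powi k) (at t)"
      by (auto intro!: derivative_eq_intros)
    moreover have eq: "f (t - e) + 2 powi k * (s - (t - e)) = f s" if "s \<in> {t - e<..<t + e}" for s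
      using bspec[OF k, of s] that by simp
    ultimately have "(f has_real_derivative 2 powi k) (at t)"
      by (elim has_field_derivative_transform_within_open[where S = "{t - e<..<t + e}"])
         (use e(1) eq in auto)
    then show ?thesis using has_field_derivative_at_within by blast
  qed
  moreover have "D \<union> {0, 1} \<subseteq> dyadic_rationals"
    using D dyadic_of_int[of 0] dyadic_of_int[of 1] by auto
  ultimately show "f \<in> F_set"
    unfolding F_set_def using f D(1) by (intro CollectI conjI exI[of _ "D \<union> {0, 1}"] ballI) auto
qed

text \<open>Splitting off the last affine piece before \<open>x\<close> drives the inductions on the
  number of break points below \<open>x\<close>.\<close>

lemma obtain_last_break:
  assumes "finite D" "{a<..<x} \<inter> D \<noteq> {}"
  obtains d :: real where "d \<in> D" "a < d" "d < x" "{d<..<x} \<inter> D = {}"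
proof -
  define d where "d = Max ({a<..<x} \<inter> D)"
  have d: "d \<in> {a<..<x} \<inter> D" unfolding d_def using assms by (intro Max_in) auto
  have le: "s \<le> d" if "s \<in> {a<..<x} \<inter> D" for s
    unfolding d_def using assms(1) that by (intro Max_ge) auto
  have "{d<..<x} \<inter> D = {}"
  proof (rule equals0I)
    fix s assume "s \<in> {d<..<x} \<inter> D"
    then show False using le[of s] d by auto
  qed
  with d show ?thesis by (intro that[of d]) auto
qed

text \<open>Every affine piece has a positive slope; the pieces are chained by induction on the
  number of breaks in between.\<close>

lemma gap_affine_strict_mono:
  assumes ga: "gap_affine D f" "finite D" and "0 \<le> a" "a < x" "x \<le> 1"
  shows "f a < f x"
  using assms(4,5)
proof (induction "card (D \<inter> {a<..<x})" arbitrary: x rule: less_induct)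
  case less
  show ?case
  proof (cases "{a<..<x} \<inter> D = {}")
    case True
    then obtain k :: int where "f x = f a + 2 powi k * (x - a)"
      using gap_affine_ends[OF ga(1), of a x] assms(3) less.prems by force
    then show ?thesis using less.prems by simp
  next
    case False
    obtain d where d: "d \<in> D" "a < d" "d < x" "{d<..<x} \<inter> D = {}"
      using obtain_last_break[OF ga(2) False] by blast
    then obtain k :: int where "f x = f d + 2 powi k * (x - d)"
      using gap_affine_ends[OF ga(1), of d x] assms(3) less.prems d by force
    then have "f d < f x" using d by simp
    moreover have "f a < f d"
    proof (rule less.hyps)
      show "card (D \<inter> {a<..<d}) < card (D \<inter> {a<..<x})"
        using ga(2) d by (intro psubset_card_mono) auto
    qed (use d less.prems in auto)
    ultimately show ?thesis by simp
  qed
qed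

text \<open>Going from 0 upwards, each piece starts at a dyadic point with a dyadic value and has a
  power of 2 as slope, so it preserves and reflects dyadic rationals.\<close>

lemma gap_affine_dyadic_iff:
  assumes ga: "gap_affine D f" "finite D" "D \<subseteq> dyadic_rationals" and "f 0 = 0"
    and "0 \<le> x" "x \<le> 1"
  shows "f x \<in> dyadic_rationals \<longleftrightarrow> x \<in> dyadic_rationals"
  using assms(5,6)
proof (induction "card (D \<inter> {0<..<x})" arbitrary: x rule: less_induct)
  case less
  have z: "0 \<in> dyadic_rationals" using dyadic_of_int[of 0] by simp
  show ?case
  proof (cases "x = 0")
    case True
    then show ?thesis using assms(4) by simp
  next
    case x: False
    show ?thesis
    proof (cases "{0<..<x} \<inter> D = {}")
      case True
      then obtain k :: int where "f x = f 0 + 2 powi k * (x - 0)"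
        using gap_affine_ends[OF ga(1), of 0 x] less.prems x True by force
      then show ?thesis using assms(4) dyadic_affine_iff[OF z z, of k x] by simp
    next
      case False
      obtain d where d: "d \<in> D" "0 < d" "d < x" "{d<..<x} \<inter> D = {}"
        using obtain_last_break[OF ga(2) False] by blast
      then obtain k :: int where k: "f x = f d + 2 powi k * (x - d)"
        using gap_affine_ends[OF ga(1), of d x] less.prems d by force
      have "f d \<in> dyadic_rationals \<longleftrightarrow> d \<in> dyadic_rationals"
      proof (rule less.hyps)
        show "card (D \<inter> {0<..<d}) < card (D \<inter> {0<..<x})"
          using ga(2) d by (intro psubset_card_mono) auto
      qed (use d less.prems in auto)
      then have "d \<in> dyadic_rationals" "f d \<in> dyadic_rationals" using d ga(3) by auto
      then show ?thesis using k dyadic_affine_iff[of d "f d" k x] by metis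
    qed
  qed
qed

section \<open>Tree diagrams and leaf signs\<close>

lemma binary_value_summable: "summable (\<lambda>n. of_bool (\<gamma> !! n) / 2 ^ Suc n :: real)"
  by (rule summable_comparison_test'[where N = 0, OF sums_summable[OF power_half_series]])
     (simp add: power_divide)

lemma binary_value_nonneg: "0 \<le> binary_value \<gamma>"
  unfolding binary_value_def by (rule suminf_nonneg[OF binary_value_summable]) simp

lemma binary_value_le_1: "binary_value \<gamma> \<le> 1"
proof -
  have "binary_value \<gamma> \<le> (\<Sum>n. (1 / 2) ^ Suc n)"
    unfolding binary_value_def
    by (rule suminf_le[OF _ binary_value_summable sums_summable[OF power_half_series]])
       (simp add: power_divide)
  also have "\<dots> = 1" using sums_unique[OF power_half_series] by simp
  finally show ?thesis .
qed

lemma binary_value_Cons: "binary_value (b ## \<gamma>) = (of_bool b + binary_value \<gamma>) / 2"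
proof -
  have "binary_value (b ## \<gamma>) = (\<Sum>n. of_bool (\<gamma> !! n) / 2 ^ Suc n / 2) + of_bool b / 2"
    using suminf_split_head[OF binary_value_summable[of "b ## \<gamma>"]]
    unfolding binary_value_def by (simp add: mult.commute)
  also have "(\<Sum>n. of_bool (\<gamma> !! n) / 2 ^ Suc n / 2) = binary_value \<gamma> / 2"
    unfolding binary_value_def by (rule suminf_divide[OF binary_value_summable])
  finally show ?thesis by (simp add: field_simps)
qed

section \<open>Grafting and common refinement of trees\<close>

text \<open>Grafting one list of trees onto both trees of a diagram inserts opposing carets in bulk,
  which leaves the represented element unchanged. The list is meant to have one tree for each
  leaf.\<close>

fun graft :: "btree \<Rightarrow> btree list \<Rightarrow> btree" where
  "graft Leaf ts = hd ts"
| "graft (Caret l r) ts =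
     Caret (graft l (take (length (leaves l)) ts)) (graft r (drop (length (leaves l)) ts))"

lemma leaves_graft:
  "length ts = length (leaves T) \<Longrightarrow>
     leaves (graft T ts) = concat (map2 (\<lambda>\<alpha> t. map ((@) \<alpha>) (leaves t)) (leaves T) ts)"
proof (induction T arbitrary: ts)
  case Leaf
  then obtain t where "ts = [t]" by (auto simp: length_Suc_conv)
  then show ?case by (simp add: map_idI)
next
  case (Caret l r)
  define us where "us = take (length (leaves l)) ts"
  define vs where "vs = drop (length (leaves l)) ts"
  have len: "length us = length (leaves l)" "length vs = length (leaves r)"
    using Caret.prems by (simp_all add: us_def vs_def)
  have ts: "ts = us @ vs" by (simp add: us_def vs_def)
  have app: "(@) (b # \<alpha>) = (\<lambda>w. b # \<alpha> @ w)" for b :: bool and \<alpha> by auto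
  have "leaves (graft (Caret l r) ts) =
      map ((#) False) (leaves (graft l us)) @ map ((#) True) (leaves (graft r vs))"
    by (simp add: us_def vs_def)
  also have "\<dots> = concat (map2 (\<lambda>\<alpha> t. map ((@) \<alpha>) (leaves t)) (leaves (Caret l r)) ts)"
    unfolding ts Caret.IH(1)[OF len(1)] Caret.IH(2)[OF len(2)]
    by (simp add: len zip_map1 map_concat o_def case_prod_unfold app)
  finally show ?case .
qed

lemma graft_Leaf: "graft T (replicate (length (leaves T)) Leaf) = T"
proof (induction T)
  case (Caret l r)
  then show ?case by (simp add: min_def)
qed simp

lemma graft_Caret_append:
  "length us = length (leaves l) \<Longrightarrow> graft (Caret l r) (us @ vs) = Caret (graft l us) (graft r vs)"
  by simp

text \<open>If one tree is a single leaf, the other is grafted onto it; otherwise the left and the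
  right subtrees are refined separately. This is the device for composing two tree diagrams.\<close>

lemma common_refinement:
  "\<exists>ts us. length ts = length (leaves T) \<and> length us = length (leaves U) \<and> graft T ts = graft U us"
proof (induction T arbitrary: U)
  case Leaf
  show ?case
    by (rule exI[of _ "[U]"], rule exI[of _ "replicate (length (leaves U)) Leaf"])
       (simp add: graft_Leaf)
next
  case (Caret l r)
  show ?case
  proof (cases U)
    case Leaf
    then show ?thesis
      by (intro exI[of _ "replicate (length (leaves (Caret l r))) Leaf"] exI[of _ "[Caret l r]"])
         (simp only: graft_Leaf, simp)
  next
    case U: (Caret l' r')
    obtain ts us where l: "length ts = length (leaves l)" "length us = length (leaves l')"
      "graft l ts = graft l' us" using Caret.IH(1)[of l'] by blast
    obtain ts' us' where r: "length ts' = length (leaves r)" "length us' = length (leaves r')"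
      "graft r ts' = graft r' us'" using Caret.IH(2)[of r'] by blast
    show ?thesis
      by (rule exI[of _ "ts @ ts'"], rule exI[of _ "us @ us'"])
         (simp add: l r U del: graft.simps add: graft_Caret_append)
  qed
qed

lemma list_all2_concat_map2:
  assumes "list_all2 P xs ys" "length ts = length xs"
    and "\<And>x y t. P x y \<Longrightarrow> list_all2 Q (F x t) (F y t)"
  shows "list_all2 Q (concat (map2 F xs ts)) (concat (map2 F ys ts))"
  using assms(1,2)
proof (induction xs ys arbitrary: ts rule: list_all2_induct)
  case (Cons x xs y ys)
  then obtain t ts' where "ts = t # ts'" by (metis length_Suc_conv)
  then show ?case using Cons by (auto intro!: list_all2_appendI assms(3))
qed simp

text \<open>Below a pair of matching leaves the grafted trees agree, so the new matching leaves
  arise by appending the same suffix to both.\<close>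

lemma list_all2_leaves_graft:
  assumes "list_all2 P (leaves T) (leaves U)" "length ts = length (leaves T)"
    and "\<And>\<alpha> \<beta> \<delta>. P \<alpha> \<beta> \<Longrightarrow> P (\<alpha> @ \<delta>) (\<beta> @ \<delta>)"
  shows "list_all2 P (leaves (graft T ts)) (leaves (graft U ts))"
proof -
  have "length ts = length (leaves U)" using assms(1,2) by (simp add: list_all2_lengthD)
  then show ?thesis
    unfolding leaves_graft[OF assms(2)] leaves_graft[OF \<open>length ts = length (leaves U)\<close>]
    by (intro list_all2_concat_map2[OF assms(1,2)])
       (auto simp: list_all2_map1 list_all2_map2 list_all2_same intro: assms(3))
qed

lemma leaves_nonempty: "leaves T \<noteq> []"
  by (induction T) auto

lemma Nil_in_leaves_iff: "[] \<in> set (leaves T) \<longleftrightarrow> T = Leaf"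
  by (cases T) auto

lemma length_leaves_eq_1_iff: "length (leaves T) = 1 \<longleftrightarrow> T = Leaf"
proof (cases T)
  case (Caret l r)
  have "0 < length (leaves l)" "0 < length (leaves r)" using leaves_nonempty by auto
  then have "length (leaves l) + length (leaves r) \<noteq> 1" by linarith
  then show ?thesis using Caret by simp
qed simp

text \<open>The empty word is a leaf of the one-leaf tree only, and that tree is recognized by its
  number of leaves.\<close>

lemma leaves_Nil_iff:
  assumes "length (leaves T) = length (leaves U)"
  shows "list_all2 (\<lambda>\<alpha> \<beta>. \<alpha> = [] \<longleftrightarrow> \<beta> = []) (leaves T) (leaves U)"
proof (cases "T = Leaf")
  case True
  then have "U = Leaf" using assms length_leaves_eq_1_iff by metis
  then show ?thesis using True by simp
next
  case False
  then have "U \<noteq> Leaf" using assms length_leaves_eq_1_iff by metis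
  then have "leaves T ! k \<noteq> []" "leaves U ! k \<noteq> []" if "k < length (leaves T)" for k
    using False assms that Nil_in_leaves_iff by (metis nth_mem)+
  then show ?thesis using assms by (simp add: list_all2_conv_all_nth)
qed

section \<open>Arithmetic modulo 3\<close>

lemma z3_cases: obtains "x = (0::3)" | "x = 1" | "x = 2"
  using exhaust_3[of x] by fastforce

lemma z3_double: "x + x = - (x::3)"
  by (cases x rule: z3_cases) auto

lemma z3_square: "x \<noteq> 0 \<Longrightarrow> x * x = (1::3)"
  by (cases x rule: z3_cases) auto

text \<open>The nonzero elements are 1 and -1, and different ones cancel. This is why the color
  between two children is forced.\<close>

lemma z3_nonzero_sum: "x \<noteq> 0 \<Longrightarrow> y \<noteq> 0 \<Longrightarrow> x + y \<noteq> (0::3) \<Longrightarrow> x = y"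
  by (cases x rule: z3_cases; cases y rule: z3_cases) auto

section \<open>Recursive form of the separation condition\<close>

lemma descendant_leaves_Nil: "descendant_leaves T [] = {1..length (leaves T)}"
  unfolding descendant_leaves_def by auto

lemma descendant_leaves_False: "descendant_leaves (Caret l r) (False # v) = descendant_leaves l v"
proof (intro subset_antisym subsetI)
  fix i assume "i \<in> descendant_leaves (Caret l r) (False # v)"
  then have i: "1 \<le> i" "i \<le> length (leaves l) + length (leaves r)"
    "prefix (False # v) (leaves (Caret l r) ! (i - 1))"
    unfolding descendant_leaves_def by auto
  have "i - 1 < length (leaves l)"
  proof (rule ccontr)
    assume n: "\<not> i - 1 < length (leaves l)"
    then have "i - 1 - length (leaves l) < length (leaves r)" using i(1,2) by linarith
    then show False using i(3) n by (simp add: nth_append)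
  qed
  then show "i \<in> descendant_leaves l v"
    using i unfolding descendant_leaves_def by (simp add: nth_append)
qed (auto simp: descendant_leaves_def nth_append)

lemma descendant_leaves_True:
  "descendant_leaves (Caret l r) (True # v) = (\<lambda>i. i + length (leaves l)) ` descendant_leaves r v"
proof (intro subset_antisym subsetI)
  fix i assume "i \<in> descendant_leaves (Caret l r) (True # v)"
  then have i: "1 \<le> i" "i \<le> length (leaves l) + length (leaves r)"
    "prefix (True # v) (leaves (Caret l r) ! (i - 1))"
    unfolding descendant_leaves_def by auto
  then have ge: "length (leaves l) < i"
    by (auto simp: nth_append split: if_splits)
  then have "i - length (leaves l) \<in> descendant_leaves r v"
    using i unfolding descendant_leaves_def by (auto simp: nth_append diff_right_commute split: if_splits)
  then show "i \<in> (\<lambda>i. i + length (leaves l)) ` descendant_leaves r v"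
    using ge by (auto intro!: image_eqI[of _ _ "i - length (leaves l)"])
qed (auto simp: descendant_leaves_def nth_append)

text \<open>Unlike in \<open>separates_colors\<close>, the root is included: the root of a proper
  subtree is a non-root vertex of the whole tree, so this is the version that recurses.\<close>

definition all_separated :: "btree \<Rightarrow> (nat \<Rightarrow> 3) \<Rightarrow> bool" where
  "all_separated T c \<longleftrightarrow>
     (\<forall>v\<in>vertices T. \<forall>p q. p < q \<longrightarrow> descendant_leaves T v = {p+1..q} \<longrightarrow> c p \<noteq> c q)"

lemma separated_root_iff:
  "(\<forall>p q. p < q \<longrightarrow> descendant_leaves T [] = {p+1..q} \<longrightarrow> c p \<noteq> c q) \<longleftrightarrow> c 0 \<noteq> c (length (leaves T))"
  using leaves_nonempty[of T] by (auto simp: descendant_leaves_Nil Icc_eq_Icc)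

lemma separated_True_iff:
  "(\<forall>p q. p < q \<longrightarrow> descendant_leaves (Caret l r) (True # v) = {p+1..q} \<longrightarrow> c p \<noteq> c q) \<longleftrightarrow>
   (\<forall>p q. p < q \<longrightarrow> descendant_leaves r v = {p+1..q} \<longrightarrow>
     c (p + length (leaves l)) \<noteq> c (q + length (leaves l)))"
  (is "?L \<longleftrightarrow> ?R")
proof
  assume ?L
  show ?R
  proof (intro allI impI)
    fix p q assume "p < q" "descendant_leaves r v = {p+1..q}"
    then have "descendant_leaves (Caret l r) (True # v) =
        {p + length (leaves l) + 1..q + length (leaves l)}"
      unfolding descendant_leaves_True by (simp add: image_add_atLeastAtMost')
    then show "c (p + length (leaves l)) \<noteq> c (q + length (leaves l))"
      using \<open>?L\<close> \<open>p < q\<close> by simp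
  qed
next
  assume R: ?R
  show ?L
  proof (intro allI impI)
    fix p q assume pq: "p < q" and eq: "descendant_leaves (Caret l r) (True # v) = {p+1..q}"
    define n where "n = length (leaves l)"
    have eq': "(\<lambda>i. i + n) ` descendant_leaves r v = {p+1..q}"
      using eq unfolding descendant_leaves_True n_def .
    then have "p + 1 \<in> (\<lambda>i. i + n) ` descendant_leaves r v" using pq by simp
    \<comment> \<open>Leaves are numbered from 1, so \<open>p + 1\<close> is at least
      \<open>n + 1\<close> and the subtraction \<open>p - n\<close> is not truncated.\<close>
    then have np: "n \<le> p" unfolding descendant_leaves_def by auto
    then have "(\<lambda>i. i + n) ` {p - n + 1..q - n} = {p+1..q}"
      using pq by (simp add: image_add_atLeastAtMost')
    then have "descendant_leaves r v = {p - n + 1..q - n}"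
      using eq' by (metis (no_types, lifting) inj_image_eq_iff injI add_right_cancel)
    moreover have "p - n < q - n" using np pq by simp
    ultimately have "c (p - n + n) \<noteq> c (q - n + n)" using R unfolding n_def by blast
    then show "c p \<noteq> c q" using np pq by simp
  qed
qed

lemma separates_colors_Caret:
  "separates_colors (Caret l r) c \<longleftrightarrow>
     all_separated l c \<and> all_separated r (\<lambda>i. c (i + length (leaves l)))"
proof -
  have "vertices (Caret l r) - {[]} = (#) False ` vertices l \<union> (#) True ` vertices r" by auto
  then show ?thesis
    unfolding separates_colors_def all_separated_def
    by (simp only: ball_Un ball_simps separated_True_iff descendant_leaves_False)
qed

lemma all_separated_iff:
  "all_separated T c \<longleftrightarrow> c 0 \<noteq> c (length (leaves T)) \<and> separates_colors T c"
proof -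
  have "vertices T = insert [] (vertices T - {[]})" by (cases T) auto
  then show ?thesis
    unfolding separates_colors_def all_separated_def
    using separated_root_iff[of T c] by (metis (no_types, lifting) insert_iff)
qed

section \<open>Color jumps across leaves\<close>

text \<open>Here \<open>d\<close> is the color jump across the whole tree. Two equal child jumps
  with sum \<open>d\<close> are both \<open>- d\<close> modulo 3, whence one sign change per
  level.\<close>

definition increments :: "btree \<Rightarrow> 3 \<Rightarrow> (nat \<Rightarrow> 3) \<Rightarrow> bool" where
  "increments T d c \<longleftrightarrow>
     (\<forall>k<length (leaves T). c (Suc k) - c k = (- 1) ^ length (leaves T ! k) * d)"

lemma all_less_add_iff: "(\<forall>k<m + n. P k) \<longleftrightarrow> (\<forall>k<m. P k) \<and> (\<forall>k<n. P (k + m))" for m n :: nat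
proof
  assume R: "(\<forall>k<m. P k) \<and> (\<forall>k<n. P (k + m))"
  show "\<forall>k<m + n. P k"
  proof (intro allI impI)
    fix k assume "k < m + n"
    then show "P k" using R by (cases "k < m") (auto dest: spec[of _ "k - m"])
  qed
qed auto

lemma increments_Caret:
  "increments (Caret l r) d c \<longleftrightarrow>
     increments l (- d) c \<and> increments r (- d) (\<lambda>i. c (i + length (leaves l)))"
  unfolding increments_def by (simp add: all_less_add_iff nth_append)

text \<open>Each of the two subtrees contributes \<open>- d\<close>, and \<open>- 2 d = d\<close>
  modulo 3.\<close>

lemma increments_total: "increments T d c \<Longrightarrow> c (length (leaves T)) - c 0 = d"
proof (induction T arbitrary: d c)
  case Leaf
  then show ?case by (simp add: increments_def)
next
  case (Caret l r)
  define n where "n = length (leaves l)"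
  have "c n - c 0 = - d"
    using Caret unfolding increments_Caret n_def by blast
  moreover have "c (length (leaves r) + n) - c (0 + n) = - d"
    using Caret unfolding increments_Caret n_def by blast
  moreover have "c (length (leaves r) + n) - c 0 =
      (c (length (leaves r) + n) - c (0 + n)) + (c n - c 0)" by simp
  ultimately have "c (length (leaves r) + n) - c 0 = - d + - d" by (simp only:)
  then show ?case using z3_double[of "- d"] by (simp add: n_def add.commute)
qed

text \<open>By induction both subtrees have nonzero total jumps. Separation at the root says that
  their sum is nonzero as well, which forces them to be equal.\<close>

lemma all_separated_iff_increments: "all_separated T c \<longleftrightarrow> (\<exists>d. d \<noteq> 0 \<and> increments T d c)"
proof (induction T arbitrary: c)
  case Leaf
  show ?case
    by (auto simp: all_separated_iff separates_colors_def increments_def)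
next
  case (Caret l r)
  define n where "n = length (leaves l)"
  define c' where "c' = (\<lambda>i. c (i + n))"
  have len: "length (leaves (Caret l r)) = length (leaves r) + n" by (simp add: n_def)
  have "all_separated (Caret l r) c \<longleftrightarrow> c 0 \<noteq> c (length (leaves r) + n) \<and>
      (\<exists>d e. d \<noteq> 0 \<and> e \<noteq> 0 \<and> increments l d c \<and> increments r e c')"
    unfolding all_separated_iff[of "Caret l r"] separates_colors_Caret len
      Caret.IH(1)[of c] n_def[symmetric] c'_def[symmetric] Caret.IH(2)[of c'] by blast
  also have "\<dots> \<longleftrightarrow> (\<exists>d. d \<noteq> 0 \<and> increments (Caret l r) d c)"
  proof
    assume L: "c 0 \<noteq> c (length (leaves r) + n) \<and>
      (\<exists>d e. d \<noteq> 0 \<and> e \<noteq> 0 \<and> increments l d c \<and> increments r e c')"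
    then obtain d e where de: "d \<noteq> 0" "e \<noteq> 0" "increments l d c" "increments r e c'" by blast
    have "c n - c 0 = d" "c (length (leaves r) + n) - c n = e"
      using increments_total[OF de(3)] increments_total[OF de(4)] by (simp_all add: n_def c'_def)
    then have "d + e = c (length (leaves r) + n) - c 0" by (auto simp: algebra_simps)
    then have "d = e" using L de by (intro z3_nonzero_sum) auto
    \<comment> \<open>Both subtrees jump by \<open>d\<close>, so the whole tree jumps by
      \<open>d + d = - d\<close>.\<close>
    then show "\<exists>d. d \<noteq> 0 \<and> increments (Caret l r) d c"
      using de by (intro exI[of _ "- d"]) (simp add: increments_Caret c'_def n_def)
  next
    assume "\<exists>d. d \<noteq> 0 \<and> increments (Caret l r) d c"
    then obtain d where d: "d \<noteq> 0" "increments (Caret l r) d c" by blast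
    then have "c (length (leaves r) + n) - c 0 = d" using increments_total len by metis
    then have "c 0 \<noteq> c (length (leaves r) + n)" using d by auto
    then show "c 0 \<noteq> c (length (leaves r) + n) \<and>
      (\<exists>d e. d \<noteq> 0 \<and> e \<noteq> 0 \<and> increments l d c \<and> increments r e c')"
      using d unfolding increments_Caret c'_def n_def by (metis neg_equal_0_iff_equal)
  qed
  finally show ?case .
qed

section \<open>Leaf signs and the local criterion for three-colorability\<close>

text \<open>The sign of the jump across the leaf \<open>w\<close>, normalized by the jump across the
  right child of the root. The jump across the left child is the negative of that one because the
  outer region lies on both sides of the tree, hence the correction by the first digit.\<close>

definition leaf_sign :: "bool list \<Rightarrow> 3" where
  "leaf_sign w = (- 1) ^ length w * (if w \<noteq> [] \<and> hd w then - 1 else 1)"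

lemma leaf_sign_Nil: "leaf_sign [] = 1"
  by (simp add: leaf_sign_def)

lemma leaf_sign_append: "\<alpha> \<noteq> [] \<Longrightarrow> leaf_sign (\<alpha> @ \<delta>) = leaf_sign \<alpha> * (- 1) ^ length \<delta>"
  unfolding leaf_sign_def by (simp add: power_add)

definition sign_increments :: "btree \<Rightarrow> 3 \<Rightarrow> (nat \<Rightarrow> 3) \<Rightarrow> bool" where
  "sign_increments T m c \<longleftrightarrow>
     (\<forall>k<length (leaves T). c (Suc k) - c k = leaf_sign (leaves T ! k) * m)"

lemma sign_increments_Caret:
  "sign_increments (Caret l r) m c \<longleftrightarrow>
     increments l (- m) c \<and> increments r m (\<lambda>i. c (i + length (leaves l)))"
  unfolding sign_increments_def increments_def
  by (simp add: all_less_add_iff nth_append leaf_sign_def)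

text \<open>Equality of the first and the last color makes the total jumps of the two subtrees of
  the root opposite; \<open>m\<close> is the jump of the right one.\<close>

lemma separates_colors_iff_sign_increments:
  assumes "T \<noteq> Leaf"
  shows "c 0 = c (length (leaves T)) \<and> separates_colors T c \<longleftrightarrow> (\<exists>m. m \<noteq> 0 \<and> sign_increments T m c)"
proof -
  obtain l r where T: "T = Caret l r" using assms by (cases T) auto
  define n where "n = length (leaves l)"
  define c' where "c' = (\<lambda>i. c (i + n))"
  have len: "length (leaves T) = length (leaves r) + n" by (simp add: n_def T)
  have sep: "separates_colors T c \<longleftrightarrow>
      (\<exists>d e. d \<noteq> 0 \<and> e \<noteq> 0 \<and> increments l d c \<and> increments r e c')"
    unfolding T separates_colors_Caret all_separated_iff_increments c'_def n_def by blast
  have tot: "c (length (leaves T)) - c 0 = d + e" if "increments l d c" "increments r e c'" for d e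
    using increments_total[OF that(1)] increments_total[OF that(2)]
    by (auto simp: c'_def n_def len algebra_simps)
  show ?thesis
  proof
    assume L: "c 0 = c (length (leaves T)) \<and> separates_colors T c"
    then obtain d e where de: "d \<noteq> 0" "e \<noteq> 0" "increments l d c" "increments r e c'"
      using sep by blast
    then have "d = - e" using tot[OF de(3,4)] L by (simp add: eq_neg_iff_add_eq_0)
    then show "\<exists>m. m \<noteq> 0 \<and> sign_increments T m c"
      using de unfolding T sign_increments_Caret c'_def n_def by blast
  next
    assume "\<exists>m. m \<noteq> 0 \<and> sign_increments T m c"
    then obtain m where m: "m \<noteq> 0" "increments l (- m) c" "increments r m c'"
      unfolding T sign_increments_Caret c'_def n_def by blast
    then have "separates_colors T c" using sep by (metis neg_equal_0_iff_equal)
    then show "c 0 = c (length (leaves T)) \<and> separates_colors T c" using tot[OF m(2,3)] by simp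
  qed
qed

text \<open>A common coloring has the same jumps when read off either tree, so the leaf signs of the
  two trees are proportional. Conversely, proportional signs can be summed up to a coloring.\<close>

lemma three_colorable_iff:
  assumes len: "length (leaves T) = length (leaves U)"
  shows "three_colorable T U \<longleftrightarrow>
    (\<exists>\<epsilon>. \<epsilon> \<noteq> 0 \<and> list_all2 (\<lambda>\<alpha> \<beta>. leaf_sign \<alpha> = \<epsilon> * leaf_sign \<beta>) (leaves T) (leaves U))"
proof (cases "T = Leaf")
  case True
  then have "U = Leaf" using len length_leaves_eq_1_iff by metis
  moreover have "three_colorable Leaf Leaf"
    unfolding three_colorable_def separates_colors_def by auto
  moreover have "list_all2 (\<lambda>\<alpha> \<beta>. leaf_sign \<alpha> = 1 * leaf_sign \<beta>) (leaves Leaf) (leaves Leaf)"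
    by simp
  ultimately show ?thesis using True zero_neq_one by metis
next
  case T: False
  then have U: "U \<noteq> Leaf" using len length_leaves_eq_1_iff by metis
  have "three_colorable T U \<longleftrightarrow>
      (\<exists>c m m'. m \<noteq> 0 \<and> m' \<noteq> 0 \<and> sign_increments T m c \<and> sign_increments U m' c)"
    unfolding three_colorable_def
    using separates_colors_iff_sign_increments[OF T] separates_colors_iff_sign_increments[OF U] len
    by metis
  also have "\<dots> \<longleftrightarrow>
    (\<exists>\<epsilon>. \<epsilon> \<noteq> 0 \<and> list_all2 (\<lambda>\<alpha> \<beta>. leaf_sign \<alpha> = \<epsilon> * leaf_sign \<beta>) (leaves T) (leaves U))"
  proof
    assume "\<exists>c m m'. m \<noteq> 0 \<and> m' \<noteq> 0 \<and> sign_increments T m c \<and> sign_increments U m' c"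
    then obtain c m m' where m: "m \<noteq> 0" "m' \<noteq> 0" "sign_increments T m c" "sign_increments U m' c"
      by blast
    have "leaf_sign (leaves T ! k) = m * m' * leaf_sign (leaves U ! k)" if "k < length (leaves T)" for k
    proof -
      have "leaf_sign (leaves T ! k) * m = leaf_sign (leaves U ! k) * m'"
        using m(3,4) that len unfolding sign_increments_def by metis
      \<comment> \<open>Multiplying by \<open>m\<close> divides by it, since
        \<open>m * m = 1\<close>.\<close>
      then have "leaf_sign (leaves T ! k) * (m * m) = leaf_sign (leaves U ! k) * m' * m"
        by (simp add: mult.assoc[symmetric])
      then show ?thesis using z3_square[OF m(1)] by (simp add: ac_simps)
    qed
    moreover have "m * m' \<noteq> 0"
      using m by (metis mult.assoc mult_zero_left z3_square mult.left_neutral)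
    ultimately show "\<exists>\<epsilon>. \<epsilon> \<noteq> 0 \<and> list_all2 (\<lambda>\<alpha> \<beta>. leaf_sign \<alpha> = \<epsilon> * leaf_sign \<beta>) (leaves T) (leaves U)"
      using len by (auto simp: list_all2_conv_all_nth)
  next
    assume "\<exists>\<epsilon>. \<epsilon> \<noteq> 0 \<and> list_all2 (\<lambda>\<alpha> \<beta>. leaf_sign \<alpha> = \<epsilon> * leaf_sign \<beta>) (leaves T) (leaves U)"
    then obtain \<epsilon> where \<epsilon>: "\<epsilon> \<noteq> 0"
      "\<And>k. k < length (leaves U) \<Longrightarrow> leaf_sign (leaves T ! k) = \<epsilon> * leaf_sign (leaves U ! k)"
      using len by (auto simp: list_all2_conv_all_nth)
    \<comment> \<open>The coloring starts at 0 and has the leaf signs of \<open>T\<close> as jumps;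
      its multipliers are 1 for \<open>T\<close> and \<open>\<epsilon>\<close> for
      \<open>U\<close>.\<close>
    define c where "c = (\<lambda>i. \<Sum>k<i. leaf_sign (leaves T ! k))"
    have "sign_increments T 1 c" "sign_increments U \<epsilon> c"
      unfolding sign_increments_def c_def using \<epsilon>(2) by (auto simp: mult.commute)
    then show "\<exists>c m m'. m \<noteq> 0 \<and> m' \<noteq> 0 \<and> sign_increments T m c \<and> sign_increments U m' c"
      using \<epsilon>(1) zero_neq_one by metis
  qed
  finally show ?thesis .
qed

section \<open>Thompson's group and the even part\<close>

lemma F_homeomorphismE:
  assumes "f \<in> F_set"
  obtains g where "homeomorphism {0..1} {0..1} f g"
  using assms F_set_iff_gap_affine by blast

lemma bij_betw_F:
  assumes "f \<in> F_set"
  shows "bij_betw f {0..1} {0..1}"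
proof -
  obtain g where g: "homeomorphism {0..1} {0..1} f g" by (rule F_homeomorphismE[OF assms])
  show ?thesis
    unfolding bij_betw_def
    using homeomorphism_image1[OF g] inj_on_inverseI[of "{0..1}" g f] homeomorphism_apply1[OF g] by blast
qed

lemma F_range: "f \<in> F_set \<Longrightarrow> x \<in> {0..1} \<Longrightarrow> f x \<in> {0..1}"
  using bij_betw_F bij_betwE by blast

lemma F_surjE:
  assumes "f \<in> F_set" "y \<in> {0..1}"
  obtains x where "x \<in> {0..1}" "f x = y"
proof -
  have "y \<in> f ` {0..1}" using assms(2) bij_betw_imp_surj_on[OF bij_betw_F[OF assms(1)]] by simp
  then obtain x where "y = f x" "x \<in> {0..1}" by (rule imageE)
  then show ?thesis by (intro that[of x]) simp_all
qed

lemma F_funcset: "f \<in> F_set \<Longrightarrow> f \<in> {0..1} \<rightarrow> {0..1}"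
  by (rule Pi_I) (rule F_range)

lemma F_extensional: "f \<in> F_set \<Longrightarrow> f \<in> extensional {0..1}"
  by (simp add: F_set_def)

lemma F_compose_one: "f \<in> F_set \<Longrightarrow> compose {0..1} f (\<lambda>t\<in>{0..1}. t) = f"
  by (rule compose_Id[OF F_funcset F_extensional])

lemma F_gap_affineE:
  assumes "f \<in> F_set"
  obtains D where "finite D" "D \<subseteq> dyadic_rationals" "gap_affine D f"
  using assms F_set_iff_gap_affine by blast

lemma F_setI:
  assumes "f \<in> extensional {0..1}" "homeomorphism {0..1} {0..1} f g"
    "finite D" "D \<subseteq> dyadic_rationals" "gap_affine D f"
  shows "f \<in> F_set"
  unfolding F_set_iff_gap_affine using assms by auto

lemma F_strict_mono:
  assumes "f \<in> F_set" "0 \<le> a" "a < b" "b \<le> 1"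
  shows "f a < f b"
proof -
  obtain D where D: "finite D" "gap_affine D f" by (rule F_gap_affineE[OF assms(1)])
  show ?thesis by (rule gap_affine_strict_mono[OF D(2,1) assms(2-4)])
qed

lemma F_mono: "f \<in> F_set \<Longrightarrow> 0 \<le> a \<Longrightarrow> a \<le> b \<Longrightarrow> b \<le> 1 \<Longrightarrow> f a \<le> f b"
  using F_strict_mono[of f a b] by (cases "a = b") auto

text \<open>A strictly increasing surjection of \<open>{0..1}\<close> can attain 0 only at 0 and 1
  only at 1.\<close>

lemma F_endpoints:
  assumes f: "f \<in> F_set"
  shows "f 0 = 0" "f 1 = 1"
proof -
  obtain x where x: "x \<in> {0..1}" "f x = 0" by (rule F_surjE[OF f, of 0]) simp
  obtain y where y: "y \<in> {0..1}" "f y = 1" by (rule F_surjE[OF f, of 1]) simp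
  have "f 0 \<in> {0..1}" "f 1 \<in> {0..1}" by (intro F_range[OF f]; simp)+
  then have "\<not> 0 < x" "\<not> y < 1"
    using F_strict_mono[OF f, of 0 x] F_strict_mono[OF f, of y 1] x y by auto
  then have "x = 0" "y = 1" using x y by auto
  then show "f 0 = 0" "f 1 = 1" using x y by auto
qed

lemma F_dyadic_iff:
  assumes "f \<in> F_set" "x \<in> {0..1}"
  shows "f x \<in> dyadic_rationals \<longleftrightarrow> x \<in> dyadic_rationals"
proof -
  obtain D where D: "finite D" "D \<subseteq> dyadic_rationals" "gap_affine D f"
    by (rule F_gap_affineE[OF assms(1)])
  show ?thesis
    by (rule gap_affine_dyadic_iff[OF D(3,1,2) F_endpoints(1)[OF assms(1)]]) (use assms(2) in auto)
qed

lemma F_one: "(\<lambda>t\<in>{0..1}. t) \<in> F_set"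
proof -
  have "homeomorphism {0..1} {0..1} (\<lambda>t\<in>{0..1::real}. t) (\<lambda>t. t)"
    by (rule homeomorphism_cong[OF homeomorphism_ident]) auto
  moreover have "gap_affine {} (\<lambda>t\<in>{0..1}. t)"
    unfolding gap_affine_def by (auto intro!: exI[of _ 0])
  ultimately show ?thesis by (intro F_setI[where D = "{}"]) auto
qed

lemma F_compose:
  assumes f: "f \<in> F_set" and g: "g \<in> F_set"
  shows "compose {0..1} g f \<in> F_set"
proof -
  obtain Df where Df: "finite Df" "Df \<subseteq> dyadic_rationals" "gap_affine Df f" by (rule F_gap_affineE[OF f])
  obtain Dg where Dg: "finite Dg" "Dg \<subseteq> dyadic_rationals" "gap_affine Dg g" by (rule F_gap_affineE[OF g])
  \<comment> \<open>The composite can break where \<open>f\<close> breaks or where \<open>f\<close>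
    arrives at a break of \<open>g\<close>. The latter points are dyadic because \<open>f\<close>
    reflects dyadic rationals.\<close>
  define D where "D = Df \<union> (f -` Dg \<inter> {0..1})"
  have "finite D" unfolding D_def
    using Df(1) Dg(1) bij_betw_imp_inj_on[OF bij_betw_F[OF f]] by (auto intro: finite_vimage_IntI)
  moreover have "D \<subseteq> dyadic_rationals"
    unfolding D_def using Df(2) Dg(2) F_dyadic_iff[OF f] by auto
  moreover have "gap_affine D (compose {0..1} g f)"
    unfolding gap_affine_def
  proof (intro allI impI)
    fix a b :: real assume ab: "0 \<le> a" "a < b" "b \<le> 1" "{a<..<b} \<inter> D = {}"
    have gap_f: "{a<..<b} \<inter> Df = {}" using ab(4) unfolding D_def by blast
    obtain k :: int where k: "\<forall>t\<in>{a..b}. f t = f a + 2 powi k * (t - a)"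
      by (rule gap_affineE[OF Df(3) ab(1-3) gap_f])
    have fab: "0 \<le> f a" "f a < f b" "f b \<le> 1"
      using F_range[OF f] F_strict_mono[OF f ab(1-3)] ab by auto
    \<comment> \<open>A break of \<open>g\<close> in this interval would be \<open>f x\<close> with
      \<open>x\<close> strictly between \<open>a\<close> and \<open>b\<close>, and such an
      \<open>x\<close> belongs to \<open>D\<close>.\<close>
    have gap: "{f a<..<f b} \<inter> Dg = {}"
    proof (rule equals0I)
      fix y assume y: "y \<in> {f a<..<f b} \<inter> Dg"
      then have "y \<in> {0..1}" using fab by auto
      then obtain x where x: "x \<in> {0..1}" "f x = y" by (rule F_surjE[OF f])
      have "\<not> x \<le> a" "\<not> b \<le> x"
        using y x F_mono[OF f, of x a] F_mono[OF f, of b x] ab by auto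
      then have "x \<in> {a<..<b}" by simp
      moreover have "x \<in> D" using x y unfolding D_def by blast
      ultimately show False using ab(4) by blast
    qed
    obtain j :: int where j: "\<forall>t\<in>{f a..f b}. g t = g (f a) + 2 powi j * (t - f a)"
      by (rule gap_affineE[OF Dg(3) fab gap])
    have "compose {0..1} g f t = compose {0..1} g f a + 2 powi (j + k) * (t - a)" if t: "t \<in> {a..b}" for t
    proof -
      have "f t \<in> {f a..f b}"
        using t ab(1-3) F_mono[OF f, of a t] F_mono[OF f, of t b] by simp
      then have "g (f t) = g (f a) + 2 powi j * (f t - f a)" by (rule bspec[OF j])
      moreover have "f t - f a = 2 powi k * (t - a)" using bspec[OF k t] by simp
      ultimately show ?thesis using t ab(1-3) by (simp add: compose_eq power_int_add)
    qed
    then show "\<exists>k::int. \<forall>t\<in>{a..b}. compose {0..1} g f t = compose {0..1} g f a + 2 powi k * (t - a)"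
      by (intro exI[of _ "j + k"] ballI)
  qed
  moreover obtain f' g' where fg: "homeomorphism {0..1} {0..1} f f'" "homeomorphism {0..1} {0..1} g g'"
    using F_homeomorphismE[OF f] F_homeomorphismE[OF g] by metis
  have "homeomorphism {0..1} {0..1} (compose {0..1} g f) (f' \<circ> g')"
    by (rule homeomorphism_cong[OF homeomorphism_compose[OF fg]]) (simp_all add: compose_def)
  ultimately show ?thesis by (intro F_setI[where D = D]) auto
qed

text \<open>The restriction makes the inverse extensional, as membership in \<open>F_set\<close>
  demands.\<close>

definition F_inverse :: "(real \<Rightarrow> real) \<Rightarrow> real \<Rightarrow> real" where
  "F_inverse f = (\<lambda>y\<in>{0..1}. inv_into {0..1} f y)"

lemma F_inverse_left: "f \<in> F_set \<Longrightarrow> x \<in> {0..1} \<Longrightarrow> F_inverse f (f x) = x"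
  using F_range[of f x] bij_betw_inv_into_left[OF bij_betw_F] by (simp add: F_inverse_def)

lemma F_inverse_right: "f \<in> F_set \<Longrightarrow> y \<in> {0..1} \<Longrightarrow> f (F_inverse f y) = y"
  using bij_betw_inv_into_right[OF bij_betw_F] by (simp add: F_inverse_def)

lemma F_inverse_range: "f \<in> F_set \<Longrightarrow> y \<in> {0..1} \<Longrightarrow> F_inverse f y \<in> {0..1}"
  using bij_betwE[OF bij_betw_inv_into[OF bij_betw_F]] by (simp add: F_inverse_def)

lemma F_inverse_in_F:
  assumes f: "f \<in> F_set"
  shows "F_inverse f \<in> F_set"
proof -
  let ?g = "F_inverse f"
  obtain D where D: "finite D" "D \<subseteq> dyadic_rationals" "gap_affine D f" by (rule F_gap_affineE[OF f])
  \<comment> \<open>The inverse breaks at the images of the breaks of \<open>f\<close>; its slopes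
    are the reciprocals \<open>2 powi (- k)\<close>.\<close>
  define D' where "D' = f ` (D \<inter> {0..1})"
  have "finite D'" using D(1) unfolding D'_def by blast
  moreover have "D' \<subseteq> dyadic_rationals"
    unfolding D'_def using D(2) F_dyadic_iff[OF f] by auto
  moreover have "gap_affine D' ?g"
    unfolding gap_affine_def
  proof (intro allI impI)
    fix a b :: real assume ab: "0 \<le> a" "a < b" "b \<le> 1" "{a<..<b} \<inter> D' = {}"
    have mono: "?g s \<le> ?g t" if "s \<in> {0..1}" "t \<in> {0..1}" "s \<le> t" for s t
    proof (rule ccontr)
      assume "\<not> ?g s \<le> ?g t"
      then have "f (?g t) < f (?g s)"
        using that F_inverse_range[OF f] by (intro F_strict_mono[OF f]) auto
      then show False using that F_inverse_right[OF f] by simp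
    qed
    define u where "u = ?g a"
    define v where "v = ?g b"
    have uv: "u \<in> {0..1}" "v \<in> {0..1}" "f u = a" "f v = b"
      using ab F_inverse_range[OF f] F_inverse_right[OF f] by (auto simp: u_def v_def)
    have less: "u < v"
      using mono[of a b] ab uv unfolding u_def v_def by (metis atLeastAtMost_iff less_le nle_le order.trans)
    have gap: "{u<..<v} \<inter> D = {}"
    proof (rule equals0I)
      fix x assume x: "x \<in> {u<..<v} \<inter> D"
      then have "f u < f x" "f x < f v"
        using uv by (auto intro!: F_strict_mono[OF f])
      then have "f x \<in> {a<..<b} \<inter> D'" using x uv unfolding D'_def by auto
      then show False using ab(4) by blast
    qed
    obtain k :: int where k: "\<forall>t\<in>{u..v}. f t = f u + 2 powi k * (t - u)"
      by (rule gap_affineE[OF D(3) _ less _ gap]) (use uv in auto)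
    have "?g t = ?g a + 2 powi (- k) * (t - a)" if t: "t \<in> {a..b}" for t
    proof -
      have "?g t \<in> {u..v}" using mono[of a t] mono[of t b] t ab unfolding u_def v_def by auto
      then have "f (?g t) = a + 2 powi k * (?g t - u)" using bspec[OF k, of "?g t"] uv(3) by simp
      then have "t - a = 2 powi k * (?g t - u)" using F_inverse_right[OF f, of t] t ab by auto
      then show ?thesis by (simp add: u_def power_int_minus mult.assoc[symmetric])
    qed
    then show "\<exists>k::int. \<forall>t\<in>{a..b}. ?g t = ?g a + 2 powi k * (t - a)" by blast
  qed
  moreover obtain g where g: "homeomorphism {0..1} {0..1} f g" by (rule F_homeomorphismE[OF f])
  have "homeomorphism {0..1} {0..1} ?g f"
  proof (rule homeomorphism_cong[OF homeomorphism_symD[OF g]])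
    fix y :: real assume y: "y \<in> {0..1}"
    then have "g y \<in> {0..1}" "f (g y) = y" using g unfolding homeomorphism_def by auto
    then show "?g y = g y" using F_inverse_left[OF f] by metis
  qed auto
  ultimately show ?thesis by (intro F_setI[where D = D']) (auto simp: F_inverse_def)
qed

section \<open>The group structure\<close>

lemma carrier_thompson_F [simp]: "carrier thompson_F = F_set"
  by (simp add: thompson_F_def)

lemma mult_thompson_F [simp]: "f \<otimes>\<^bsub>thompson_F\<^esub> g = compose {0..1} g f"
  by (simp add: thompson_F_def)

lemma one_thompson_F [simp]: "\<one>\<^bsub>thompson_F\<^esub> = (\<lambda>t\<in>{0..1}. t)"
  by (simp add: thompson_F_def)

lemma F_inverse_compose:
  "f \<in> F_set \<Longrightarrow> compose {0..1} f (F_inverse f) = (\<lambda>t\<in>{0..1}. t)"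
  by (auto simp: compose_def F_inverse_right)

lemma group_thompson_F: "group thompson_F"
proof (rule groupI; simp only: carrier_thompson_F mult_thompson_F one_thompson_F)
  fix f g h assume "f \<in> F_set" "g \<in> F_set" "h \<in> F_set"
  then show "compose {0..1} h (compose {0..1} g f) = compose {0..1} (compose {0..1} h g) f"
    by (intro compose_assoc F_funcset)
next
  fix f assume "f \<in> F_set"
  then show "\<exists>g\<in>F_set. compose {0..1} f g = (\<lambda>t\<in>{0..1}. t)"
    using F_inverse_in_F F_inverse_compose by blast
qed (auto simp: F_compose F_one F_compose_one)

interpretation thompson: group thompson_F
  by (rule group_thompson_F)

lemma inv_thompson_F: "f \<in> F_set \<Longrightarrow> inv\<^bsub>thompson_F\<^esub> f = F_inverse f"
  by (intro thompson.inv_equality) (simp_all add: F_inverse_in_F F_inverse_compose)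

section \<open>Slopes at the endpoints and the subgroup \<open>K22\<close>\<close>

definition has_slope :: "real \<Rightarrow> int \<Rightarrow> (real \<Rightarrow> real) \<Rightarrow> bool" where
  "has_slope t k f \<longleftrightarrow> (f has_real_derivative 2 powi k) (at t within {0..1})"

lemma derivative_unique_01:
  assumes "t \<in> {0, 1}" "(f has_real_derivative r) (at t within {0..1})"
    "(f has_real_derivative s) (at t within {0..1})"
  shows "r = s"
  by (rule vector_derivative_unique_within_closed_interval[of 0 1 t f])
     (use assms in \<open>auto simp: has_real_derivative_iff_has_vector_derivative\<close>)

lemma powi_inj: "(2::real) powi k = 2 powi j \<Longrightarrow> k = j"
  using power_int_strict_increasing[of k j "2::real"] power_int_strict_increasing[of j k "2::real"]
  by (cases k j rule: linorder_cases) auto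

lemma has_slope_unique: "t \<in> {0, 1} \<Longrightarrow> has_slope t k f \<Longrightarrow> has_slope t j f \<Longrightarrow> k = j"
  unfolding has_slope_def using derivative_unique_01 powi_inj by blast

lemma has_slope_exists:
  assumes f: "f \<in> F_set" and t: "t \<in> {0, 1}"
  shows "\<exists>k. has_slope t k f"
proof -
  obtain D where D: "finite D" "gap_affine D f" by (rule F_gap_affineE[OF f])
  obtain d where d: "d > 0" "\<And>x. x \<in> D \<Longrightarrow> x \<noteq> t \<Longrightarrow> d \<le> dist t x"
    using finite_set_avoid[OF D(1)] by blast
  define e where "e = min d 1"
  \<comment> \<open>The interval from \<open>a\<close> to \<open>a + e\<close> is a one-sided
    neighborhood of \<open>t\<close> in \<open>{0..1}\<close> whose interior contains no break
    point.\<close>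
  define a where "a = (if t = 0 then 0 else 1 - e)"
  have e: "0 < e" "e \<le> 1" "e \<le> d" using d(1) by (auto simp: e_def)
  have a: "0 \<le> a" "a < a + e" "a + e \<le> 1" using e by (auto simp: a_def)
  have gap: "{a<..<a + e} \<inter> D = {}"
  proof (rule equals0I)
    fix x assume x: "x \<in> {a<..<a + e} \<inter> D"
    then have "x \<noteq> t" "dist t x < e" using t by (auto simp: a_def dist_real_def split: if_splits)
    then show False using d(2)[of x] x e(3) by auto
  qed
  obtain k :: int where k: "\<forall>x\<in>{a..a + e}. f x = f a + 2 powi k * (x - a)"
    by (rule gap_affineE[OF D(2) a gap])
  have "((\<lambda>x. f a + 2 powi k * (x - a)) has_real_derivative 2 powi k) (at t within {0..1})"
    by (auto intro!: derivative_eq_intros)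
  then have "(f has_real_derivative 2 powi k) (at t within {0..1})"
  proof (rule has_field_derivative_transform_within[OF _ e(1)])
    fix x :: real assume "x \<in> {0..1}" "dist x t < e"
    then have "x \<in> {a..a + e}" using t by (auto simp: a_def dist_real_def)
    then show "f a + 2 powi k * (x - a) = f x" by (rule bspec[OF k, symmetric])
  qed (use t in auto)
  then show ?thesis unfolding has_slope_def by blast
qed

definition slope_exp :: "real \<Rightarrow> (real \<Rightarrow> real) \<Rightarrow> int" where
  "slope_exp t f = (THE k. has_slope t k f)"

lemma slope_exp_eq: "t \<in> {0, 1} \<Longrightarrow> has_slope t k f \<Longrightarrow> slope_exp t f = k"
  unfolding slope_exp_def using has_slope_unique by blast

lemma has_slope_slope_exp: "f \<in> F_set \<Longrightarrow> t \<in> {0, 1} \<Longrightarrow> has_slope t (slope_exp t f) f"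
  using has_slope_exists slope_exp_eq by blast

text \<open>Elements of F fix both endpoints, so by the chain rule the slopes at an endpoint
  multiply. The exponent is thus a homomorphism from F to the integers.\<close>

lemma slope_exp_compose:
  assumes "f \<in> F_set" "g \<in> F_set" and t: "t \<in> {0, 1}"
  shows "slope_exp t (compose {0..1} g f) = slope_exp t f + slope_exp t g"
proof (rule slope_exp_eq[OF t])
  have ft: "f t = t" using F_endpoints[OF assms(1)] t by auto
  have im: "f ` {0..1} = {0..1}" using bij_betw_imp_surj_on[OF bij_betw_F[OF assms(1)]] .
  have "(g \<circ> f has_real_derivative 2 powi slope_exp t g * 2 powi slope_exp t f) (at t within {0..1})"
    using has_slope_slope_exp[OF assms(1) t] has_slope_slope_exp[OF assms(2) t]
    unfolding has_slope_def by (intro DERIV_image_chain) (simp_all add: ft im)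
  then have "(compose {0..1} g f has_real_derivative 2 powi slope_exp t g * 2 powi slope_exp t f)
      (at t within {0..1})"
    by (rule has_field_derivative_transform_within[where d = 1]) (use t in \<open>auto simp: compose_def\<close>)
  then show "has_slope t (slope_exp t f + slope_exp t g) (compose {0..1} g f)"
    unfolding has_slope_def by (simp add: power_int_add mult.commute)
qed

lemma slope_exp_one: "t \<in> {0, 1} \<Longrightarrow> slope_exp t (\<lambda>t\<in>{0..1}. t) = 0"
  using slope_exp_compose[OF F_one F_one, of t] by (simp add: F_compose_one F_one)

lemma slope_exp_inverse:
  "f \<in> F_set \<Longrightarrow> t \<in> {0, 1} \<Longrightarrow> slope_exp t (F_inverse f) = - slope_exp t f"
  using slope_exp_compose[OF F_inverse_in_F, of f f t] by (simp add: F_inverse_compose slope_exp_one)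

lemma log2_powi: "log 2 (2 powi k) = of_int k"
proof -
  have "2 powi k = 2 powr real_of_int k" by (simp add: powr_real_of_int')
  then show ?thesis by simp
qed

lemma K22_iff: "f \<in> K22 \<longleftrightarrow> f \<in> F_set \<and> (\<forall>t\<in>{0, 1}. even (slope_exp t f))"
proof -
  have "(\<exists>s. (f has_real_derivative s) (at t within {0..1}) \<and> (\<exists>k::int. log 2 s = 2 * of_int k))
      \<longleftrightarrow> even (slope_exp t f)" if f: "f \<in> F_set" and t: "t \<in> {0, 1}" for t
  proof -
    have s: "(f has_real_derivative s) (at t within {0..1}) \<longleftrightarrow> s = 2 powi slope_exp t f" for s
      using has_slope_slope_exp[OF f t] derivative_unique_01[OF t] unfolding has_slope_def by metis
    have "(\<exists>s. (f has_real_derivative s) (at t within {0..1}) \<and> (\<exists>k::int. log 2 s = 2 * of_int k))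
      \<longleftrightarrow> (\<exists>k::int. log 2 (2 powi slope_exp t f) = 2 * of_int k)"
      unfolding s by blast
    also have "\<dots> \<longleftrightarrow> (\<exists>k. slope_exp t f = 2 * k)"
      by (simp only: log2_powi of_int_eq_iff[where 'a = real, symmetric] of_int_mult of_int_numeral)
    finally show ?thesis by (simp add: dvd_def)
  qed
  then show ?thesis unfolding K22_def by blast
qed

text \<open>The last clause is needed because \<open>leaf_sign []\<close> is a junk value, so that \<open>leaf_sign_append\<close>
  fails for the root.\<close>

definition cone_pair :: "3 \<Rightarrow> (real \<Rightarrow> real) \<Rightarrow> bool list \<Rightarrow> bool list \<Rightarrow> bool" where
  "cone_pair \<epsilon> f \<alpha> \<beta> \<longleftrightarrow>
     (\<forall>\<gamma>. f (binary_value (\<alpha> @- \<gamma>)) = binary_value (\<beta> @- \<gamma>)) \<and>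
     leaf_sign \<alpha> = \<epsilon> * leaf_sign \<beta> \<and> (\<alpha> = [] \<longleftrightarrow> \<beta> = [])"

text \<open>For nonempty words both signs change by the same factor. If both words are empty, then
  \<open>\<epsilon> = 1\<close> and the two extended words coincide.\<close>

lemma cone_pair_append: "cone_pair \<epsilon> f \<alpha> \<beta> \<Longrightarrow> cone_pair \<epsilon> f (\<alpha> @ \<delta>) (\<beta> @ \<delta>)"
  unfolding cone_pair_def by (cases "\<alpha> = []") (auto simp: leaf_sign_append leaf_sign_Nil mult.assoc)

lemma cone_pair_compose:
  "cone_pair \<epsilon> f \<alpha> \<beta> \<Longrightarrow> cone_pair \<epsilon>' g \<beta> \<delta> \<Longrightarrow> cone_pair (\<epsilon> * \<epsilon>') (compose {0..1} g f) \<alpha> \<delta>"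
  unfolding cone_pair_def
  by (auto simp: compose_def binary_value_nonneg binary_value_le_1 mult.assoc)

text \<open>The constant stays the same because \<open>\<epsilon>\<close> is its own
  inverse.\<close>

lemma cone_pair_inverse:
  assumes "f \<in> F_set" "\<epsilon> \<noteq> 0" "cone_pair \<epsilon> f \<alpha> \<beta>"
  shows "cone_pair \<epsilon> (F_inverse f) \<beta> \<alpha>"
proof -
  have "F_inverse f (binary_value (\<beta> @- \<gamma>)) = binary_value (\<alpha> @- \<gamma>)" for \<gamma>
    using F_inverse_left[OF assms(1), of "binary_value (\<alpha> @- \<gamma>)"] assms(3)
    unfolding cone_pair_def by (simp add: binary_value_nonneg binary_value_le_1)
  moreover have "leaf_sign \<beta> = \<epsilon> * leaf_sign \<alpha>"
    using assms(3) z3_square[OF assms(2)] unfolding cone_pair_def by (simp add: mult.assoc[symmetric])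
  ultimately show ?thesis using assms(3) unfolding cone_pair_def by blast
qed

text \<open>Representing \<open>f\<close> and being three-colorable become one condition on matching
  leaves, which is stable under refinement.\<close>

lemma planar_3_colorable_iff:
  "f \<in> planar_3_colorable \<longleftrightarrow>
     f \<in> F_set \<and> (\<exists>T U \<epsilon>. \<epsilon> \<noteq> 0 \<and> list_all2 (cone_pair \<epsilon> f) (leaves T) (leaves U))"
proof -
  have "(tree_diagram T U \<and> represents T U f \<and> three_colorable T U) \<longleftrightarrow>
      (\<exists>\<epsilon>. \<epsilon> \<noteq> 0 \<and> list_all2 (cone_pair \<epsilon> f) (leaves T) (leaves U))" for T U
  proof (cases "length (leaves T) = length (leaves U)")
    case True
    have "list_all2 (cone_pair \<epsilon> f) (leaves T) (leaves U) \<longleftrightarrow>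
        represents T U f \<and> list_all2 (\<lambda>\<alpha> \<beta>. leaf_sign \<alpha> = \<epsilon> * leaf_sign \<beta>) (leaves T) (leaves U)" for \<epsilon>
      using leaves_Nil_iff[OF True] True
      unfolding cone_pair_def represents_def list_all2_conv_all_nth by auto
    then show ?thesis
      unfolding tree_diagram_def three_colorable_iff[OF True] using True by auto
  qed (auto simp: tree_diagram_def dest: list_all2_lengthD)
  then show ?thesis unfolding planar_3_colorable_def by simp
qed

lemma planar_3_colorableE:
  assumes "f \<in> planar_3_colorable"
  obtains T U \<epsilon> where "f \<in> F_set" "\<epsilon> \<noteq> 0" "list_all2 (cone_pair \<epsilon> f) (leaves T) (leaves U)"
  using assms unfolding planar_3_colorable_iff by (elim conjE exE) (rule that)

lemma planar_3_colorable_subset: "planar_3_colorable \<subseteq> F_set"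
  by (auto simp: planar_3_colorable_def)

lemma planar_3_colorable_one: "(\<lambda>t\<in>{0..1}. t) \<in> planar_3_colorable"
proof -
  have "cone_pair 1 (\<lambda>t\<in>{0..1}. t) [] []"
    unfolding cone_pair_def by (simp add: binary_value_nonneg binary_value_le_1)
  then have "list_all2 (cone_pair 1 (\<lambda>t\<in>{0..1}. t)) (leaves Leaf) (leaves Leaf)" by simp
  then show ?thesis unfolding planar_3_colorable_iff using F_one zero_neq_one by metis
qed

lemma planar_3_colorable_inverse:
  assumes "f \<in> planar_3_colorable"
  shows "F_inverse f \<in> planar_3_colorable"
proof -
  obtain T U \<epsilon> where f: "f \<in> F_set" "\<epsilon> \<noteq> 0" "list_all2 (cone_pair \<epsilon> f) (leaves T) (leaves U)"
    using assms by (rule planar_3_colorableE)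
  then have "list_all2 (cone_pair \<epsilon> (F_inverse f)) (leaves U) (leaves T)"
    using cone_pair_inverse[OF f(1,2)] by (auto simp: list_all2_conv_all_nth)
  then show ?thesis unfolding planar_3_colorable_iff using f(1,2) F_inverse_in_F by auto
qed

text \<open>The range tree of \<open>f\<close> and the domain tree of \<open>g\<close> are refined
  to a common tree. The cones then match up, and the sign constants multiply.\<close>

lemma planar_3_colorable_compose:
  assumes "f \<in> planar_3_colorable" "g \<in> planar_3_colorable"
  shows "compose {0..1} g f \<in> planar_3_colorable"
proof -
  obtain T U \<epsilon> where f: "f \<in> F_set" "\<epsilon> \<noteq> 0" "list_all2 (cone_pair \<epsilon> f) (leaves T) (leaves U)"
    using assms(1) by (rule planar_3_colorableE)
  obtain T' U' \<epsilon>' where g: "g \<in> F_set" "\<epsilon>' \<noteq> 0" "list_all2 (cone_pair \<epsilon>' g) (leaves T') (leaves U')"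
    using assms(2) by (rule planar_3_colorableE)
  obtain ts us where r: "length ts = length (leaves U)" "length us = length (leaves T')"
    "graft U ts = graft T' us" using common_refinement[of U T'] by blast
  have "length ts = length (leaves T)" using r(1) f(3) by (simp add: list_all2_lengthD)
  then have 1: "list_all2 (cone_pair \<epsilon> f) (leaves (graft T ts)) (leaves (graft U ts))"
    by (intro list_all2_leaves_graft[OF f(3)] cone_pair_append)
  have 2: "list_all2 (cone_pair \<epsilon>' g) (leaves (graft T' us)) (leaves (graft U' us))"
    by (intro list_all2_leaves_graft[OF g(3)] cone_pair_append r)
  have "list_all2 (cone_pair (\<epsilon> * \<epsilon>') (compose {0..1} g f)) (leaves (graft T ts)) (leaves (graft U' us))"
    by (rule list_all2_trans[OF cone_pair_compose 1 2[folded r(3)]])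
  moreover have "\<epsilon> * \<epsilon>' \<noteq> 0"
    using f(2) g(2) by (metis mult.assoc mult_zero_left z3_square mult.left_neutral)
  ultimately show ?thesis unfolding planar_3_colorable_iff using F_compose[OF f(1) g(1)] by auto
qed

section \<open>The even part and the normalizing element\<close>

lemma subgroup_E_EVEN: "subgroup E_EVEN thompson_F"
proof (rule subgroup.intro; (simp only: carrier_thompson_F mult_thompson_F one_thompson_F)?)
  show "E_EVEN \<subseteq> F_set" unfolding E_EVEN_def using planar_3_colorable_subset by blast
  show "compose {0..1} g f \<in> E_EVEN" if "f \<in> E_EVEN" "g \<in> E_EVEN" for f g
    using that unfolding E_EVEN_def
    by (auto simp: planar_3_colorable_compose K22_iff F_compose slope_exp_compose)
  show "(\<lambda>t\<in>{0..1}. t) \<in> E_EVEN"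
    unfolding E_EVEN_def by (simp add: planar_3_colorable_one K22_iff F_one slope_exp_one)
  show "inv\<^bsub>thompson_F\<^esub> f \<in> E_EVEN" if "f \<in> E_EVEN" for f
    using that unfolding E_EVEN_def
    by (auto simp: inv_thompson_F planar_3_colorable_inverse K22_iff F_inverse_in_F slope_exp_inverse)
qed

text \<open>A standard generator of F, with slopes 1/2, 1 and 2. It is convex, so it is the maximum
  of its three affine pieces.\<close>

definition x0 :: "real \<Rightarrow> real" where
  "x0 = (\<lambda>t\<in>{0..1}. max (t / 2) (max (t - 1 / 4) (2 * t - 1)))"

lemma x0_eq:
  "0 \<le> t \<Longrightarrow> t \<le> 1 / 2 \<Longrightarrow> x0 t = t / 2"
  "1 / 2 \<le> t \<Longrightarrow> t \<le> 3 / 4 \<Longrightarrow> x0 t = t - 1 / 4"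
  "3 / 4 \<le> t \<Longrightarrow> t \<le> 1 \<Longrightarrow> x0 t = 2 * t - 1"
  by (auto simp: x0_def max_def)

lemma x0_in_F: "x0 \<in> F_set"
proof -
  let ?f = "\<lambda>t::real. max (t / 2) (max (t - 1 / 4) (2 * t - 1))"
  \<comment> \<open>The inverse of a maximum of increasing affine maps is the minimum of their
    inverses.\<close>
  let ?g = "\<lambda>t::real. min (2 * t) (min (t + 1 / 4) ((t + 1) / 2))"
  have "homeomorphism {0..1} {0..1} ?f ?g"
  proof (rule homeomorphismI)
    show "continuous_on {0..1} ?f" "continuous_on {0..1} ?g"
      by (intro continuous_intros; simp)+
  qed (auto simp: max_def min_def field_simps)
  then have "homeomorphism {0..1} {0..1} x0 ?g"
    by (rule homeomorphism_cong) (auto simp: x0_def)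
  moreover have "gap_affine {1 / 2, 3 / 4} x0"
    unfolding gap_affine_def
  proof (intro allI impI)
    fix a b :: real assume ab: "0 \<le> a" "a < b" "b \<le> 1" "{a<..<b} \<inter> {1 / 2, 3 / 4} = {}"
    then have "1 / 2 \<le> a \<or> b \<le> 1 / 2" "3 / 4 \<le> a \<or> b \<le> 3 / 4" by auto
    then consider "b \<le> 1 / 2" | "1 / 2 \<le> a" "b \<le> 3 / 4" | "3 / 4 \<le> a" by linarith
    then show "\<exists>k::int. \<forall>t\<in>{a..b}. x0 t = x0 a + 2 powi k * (t - a)"
    proof cases
      case 1
      then have "x0 t = x0 a + 2 powi (- 1) * (t - a)" if "t \<in> {a..b}" for t
        using ab that by (simp add: x0_eq(1) field_simps)
      then show ?thesis by blast
    next
      case 2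
      then have "x0 t = x0 a + 2 powi 0 * (t - a)" if "t \<in> {a..b}" for t
        using ab that by (simp add: x0_eq(2))
      then show ?thesis by blast
    next
      case 3
      then have "x0 t = x0 a + 2 powi 1 * (t - a)" if "t \<in> {a..b}" for t
        using ab that by (simp add: x0_eq(3))
      then show ?thesis by blast
    qed
  qed
  moreover have "1 / 2 \<in> dyadic_rationals" "3 / 4 \<in> dyadic_rationals"
    unfolding dyadic_rationals_def
    by (rule CollectI, rule exI[of _ 1], rule exI[of _ 1], simp)
       (rule CollectI, rule exI[of _ 3], rule exI[of _ 2], simp)
  then have "{1 / 2, 3 / 4} \<subseteq> dyadic_rationals" by simp
  ultimately show ?thesis by (intro F_setI[where D = "{1 / 2, 3 / 4}"]) (auto simp: x0_def)
qed

lemma slope_exp_x0: "slope_exp 0 x0 = - 1"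
proof (rule slope_exp_eq)
  have "((\<lambda>t. t / 2) has_real_derivative 1 / 2) (at 0 within {0..1})"
    by (auto intro!: derivative_eq_intros)
  then have "(x0 has_real_derivative 1 / 2) (at 0 within {0..1})"
    by (rule has_field_derivative_transform_within[where d = "1 / 2"])
       (auto simp: x0_eq(1) dist_real_def)
  then show "has_slope 0 (- 1) x0" unfolding has_slope_def by (simp add: power_int_minus inverse_eq_divide)
qed simp

lemma x0_planar_3_colorable: "x0 \<in> planar_3_colorable"
proof -
  \<comment> \<open>The leaves 0, 10, 11 go to 00, 01, 1. The first three all have sign -1 and the
    last three all have sign 1, so the constant is -1.\<close>
  have "list_all2 (cone_pair (- 1) x0) (leaves (Caret Leaf (Caret Leaf Leaf)))
      (leaves (Caret (Caret Leaf Leaf) Leaf))"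
  proof -
    have b: "0 \<le> binary_value \<gamma>" "binary_value \<gamma> \<le> 1" for \<gamma>
      by (rule binary_value_nonneg binary_value_le_1)+
    have "x0 (s / 2) = s / 4" "x0 ((1 + s / 2) / 2) = (1 + s) / 4" "x0 ((1 + (1 + s) / 2) / 2) = (1 + s) / 2"
      if "0 \<le> s" "s \<le> 1" for s
      using that by (auto simp: x0_def max_def field_simps)
    then show ?thesis
      using b by (simp add: cone_pair_def leaf_sign_def binary_value_Cons)
  qed
  moreover have "(- 1 :: 3) \<noteq> 0" using zero_neq_one by simp
  ultimately show ?thesis unfolding planar_3_colorable_iff using x0_in_F by blast
qed

theorem corollary3p9:
  shows "reducible_on_l2 thompson_F (lcosets\<^bsub>thompson_F\<^esub> E_EVEN)
           (quasi_regular thompson_F E_EVEN)"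
proof (rule thompson.quasi_regular_reducible[OF subgroup_E_EVEN, of x0])
  show "x0 \<in> carrier thompson_F" by (simp add: x0_in_F)
  \<comment> \<open>The slope of \<open>x0\<close> at 0 is \<open>2 powi (- 1)\<close>, an odd
    power; for the square the exponents double and become even.\<close>
  show "x0 \<notin> E_EVEN" unfolding E_EVEN_def by (simp add: K22_iff slope_exp_x0)
  show "x0 \<otimes>\<^bsub>thompson_F\<^esub> x0 \<in> E_EVEN"
    unfolding E_EVEN_def
    by (simp add: K22_iff F_compose x0_in_F slope_exp_compose planar_3_colorable_compose x0_planar_3_colorable)
  \<comment> \<open>The exponents of \<open>x0\<close> and of its inverse cancel, so conjugation
    keeps the parities, and it stays in the planar 3-colorable subgroup because \<open>x0\<close>
    belongs to it.\<close>
  show "inv\<^bsub>thompson_F\<^esub> x0 \<otimes>\<^bsub>thompson_F\<^esub> h \<otimes>\<^bsub>thompson_F\<^esub> x0 \<in> E_EVEN" if "h \<in> E_EVEN" for h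
    using that unfolding E_EVEN_def
    by (simp add: K22_iff inv_thompson_F F_compose F_inverse_in_F x0_in_F slope_exp_compose
        slope_exp_inverse planar_3_colorable_compose planar_3_colorable_inverse x0_planar_3_colorable)
qed

end
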